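(* Let $K$ be a compact metric space, let $\sigma(K)$ be its Cantor-Bendixson derivation order, let $\mathrm{SEP}$ be the class of separable Banach spaces and $\mathcal{SEP}$ the class of separable metric spaces. (a) If $\sigma(K)=1$, then $$c_{C(K)}(\mathrm{SEP})=c_{C(K)}(\mathcal{SEP})=2.$$ (b) If $2\le\sigma(K)<\omega$, then $$\frac{\sigma(K)+1}{\sigma(K)}\le c_{C(K)}(\mathrm{SEP})\le c_{C(K)}(\mathcal{SEP})\le 2.$$
   Context: $C(K)$ is the Banach space of continuous functions on $K$ with the supremum norm; Banach spaces are viewed as metric spaces with their norm distance. $\omega$ is the first infinite ordinal. For metric spaces $M,N$, the distortion of a map $f\colon M\to N$ is $$\mathrm{dist}(f)=\sup_{x\neq y\in M}\frac{d_N(f(x),f(y))}{d_M(x,y)}\cdot\sup_{x\neq y\in M}\frac{d_M(x,y)}{d_N(f(x),f(y))},$$ and $f$ is a bi-Lipschitz embedding if $\mathrm{dist}(f)<\infty$. Let $c_N(M)=\inf\{\mathrm{dist}(f): f\colon M\to N \text{ a bi-Lipschitz embedding}\}$, and for a class $\mathcal F$ of metric spaces let $c_N(\mathcal F)=\sup\{c_N(M): M\in\mathcal F\}$. Cantor-Bendixson derivatives: $K'$ is the set of points of $K$ that are not isolated in $K$; $K^{(0)}=K$, $K^{(\beta+1)}=(K^{(\beta)})'$, and $K^{(\alpha)}=\bigcap_{\beta<\alpha}K^{(\beta)}$ for limit ordinals $\alpha$. The Cantor-Bendixson derivation order of $K$ is $\sigma(K)=\sup\{\alpha: K^{(\alpha)}\neq\emptyset\}$.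 *)

theory Defs
  imports "HOL-Analysis.Analysis" "HOL-Algebra.Module"
begin

section \<open>Distortion\<close>

text \<open>
  All quotients are taken in \<^typ>\<open>ennreal\<close>, so a nonzero number divided by \<open>0\<close> is \<open>\<infinity>\<close> (with
  real division it would be \<open>0\<close>).
\<close>

definition distortion :: "'a metric \<Rightarrow> 'b metric \<Rightarrow> ('a \<Rightarrow> 'b) \<Rightarrow> ennreal" where
  "distortion M N f =
     (SUP (x, y) \<in> {(x, y). x \<in> mspace M \<and> y \<in> mspace M \<and> x \<noteq> y}.
        ennreal (mdist N (f x) (f y)) / ennreal (mdist M x y)) *
     (SUP (x, y) \<in> {(x, y). x \<in> mspace M \<and> y \<in> mspace M \<and> x \<noteq> y}.
        ennreal (mdist M x y) / ennreal (mdist N (f x) (f y)))"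

text \<open>
  In \<^typ>\<open>ennreal\<close> we have \<open>0 * \<infinity> = 0\<close>, so \<^const>\<open>distortion\<close> vanishes on constant maps, which are
  not embeddings; injectivity rules them out. For an injective map on at least two points both
  suprema are positive, so that finiteness of the product is finiteness of both factors.
\<close>

definition bilipschitz_embedding :: "'a metric \<Rightarrow> 'b metric \<Rightarrow> ('a \<Rightarrow> 'b) \<Rightarrow> bool" where
  "bilipschitz_embedding M N f \<longleftrightarrow>
     f \<in> mspace M \<rightarrow> mspace N \<and> inj_on f (mspace M) \<and> distortion M N f < \<infinity>"

text \<open>The infimum is \<open>\<infinity>\<close> if there is no bi-Lipschitz embedding.\<close>

definition embedding_const :: "'b metric \<Rightarrow> 'a metric \<Rightarrow> ennreal" where
  "embedding_const N M = (INF f \<in> {f. bilipschitz_embedding M N f}. distortion M N f)"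

definition class_embedding_const :: "'b metric \<Rightarrow> 'a metric set \<Rightarrow> ennreal" where
  "class_embedding_const N F = (SUP M \<in> F. embedding_const N M)"


section \<open>Separable metric spaces and separable Banach spaces\<close>

text \<open>
  Spaces are carried by arbitrary subsets of a type \<^typ>\<open>'u\<close>, whose elements carry no structure of
  their own. A separable metric space has at most continuum many points, so if \<^typ>\<open>real\<close> injects
  into \<^typ>\<open>'u\<close>, then \<open>separable_metrics\<close> and \<open>separable_banach_metrics\<close> contain isometric copies
  of all separable metric spaces and of all separable Banach spaces, respectively.
\<close>

definition separable_metrics :: "'u metric set" where
  "separable_metrics = {M. separable_space (mtopology_of M)}"

definition real_ring :: "real ring" where
  "real_ring = \<lparr>carrier = UNIV, mult = (*), one = 1, zero = 0, add = (+)\<rparr>"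

text \<open>
  Real normed spaces with an explicit carrier. The multiplicative components \<^const>\<open>mult\<close> and
  \<^const>\<open>one\<close> of the record \<open>V\<close> are not constrained by \<^locale>\<open>module\<close>.
\<close>

locale real_normed_space = module real_ring V
  for V :: "(real, 'u) module" (structure) +
  fixes nrm :: "'u \<Rightarrow> real"
  assumes nrm_eq_0_iff: "x \<in> carrier V \<Longrightarrow> nrm x = 0 \<longleftrightarrow> x = \<zero>"
    and nrm_triangle: "\<lbrakk>x \<in> carrier V; y \<in> carrier V\<rbrakk> \<Longrightarrow> nrm (x \<oplus> y) \<le> nrm x + nrm y"
    and nrm_smult: "x \<in> carrier V \<Longrightarrow> nrm (a \<odot> x) = \<bar>a\<bar> * nrm x"

definition banach_metric :: "'u metric \<Rightarrow> bool" where
  "banach_metric M \<longleftrightarrow> mcomplete_of M \<and>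
     (\<exists>(V :: (real, 'u) module) nrm. real_normed_space V nrm \<and> carrier V = mspace M \<and>
        (\<forall>x \<in> carrier V. \<forall>y \<in> carrier V. mdist M x y = nrm (x \<ominus>\<^bsub>V\<^esub> y)))"

definition separable_banach_metrics :: "'u metric set" where
  "separable_banach_metrics = {M. banach_metric M \<and> separable_space (mtopology_of M)}"


section \<open>Cantor-Bendixson derivatives\<close>

definition cb_deriv :: "'k::topological_space set \<Rightarrow> 'k set" where
  "cb_deriv S = {x \<in> S. \<not> x isolated_in S}"

text \<open>
  Only derivatives of order at most \<open>\<omega>\<close> are needed; these ordinals form the well-ordered type
  \<^typ>\<open>enat\<close>, with \<open>\<infinity>\<close> in the role of \<open>\<omega>\<close>. Accordingly \<open>cb_order\<close> is the derivation order
  truncated at \<open>\<omega>\<close>: it is \<open>\<infinity>\<close> if the order is an infinite ordinal, or if no derivative is empty.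
\<close>

definition cb_derivative :: "'k::topological_space set \<Rightarrow> enat \<Rightarrow> 'k set" where
  "cb_derivative K \<alpha> =
     (case \<alpha> of enat n \<Rightarrow> (cb_deriv ^^ n) K | \<infinity> \<Rightarrow> (\<Inter>n::nat. (cb_deriv ^^ n) K))"

definition cb_order :: "'k::topological_space set \<Rightarrow> enat" where
  "cb_order K = Sup {\<alpha>. cb_derivative K \<alpha> \<noteq> {}}"


section \<open>Spaces of continuous functions\<close>

text \<open>
  For a type \<^typ>\<open>'k\<close> that is a compact metric space, every continuous function is bounded, so
  \<^typ>\<open>'k \<Rightarrow>\<^sub>C real\<close> is the Banach space of all continuous functions with the supremum norm.
\<close>

abbreviation C_metric :: "('k::metric_space \<Rightarrow>\<^sub>C real) metric" where
  "C_metric \<equiv> euclidean_metric"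

end

(*
  Lower bound. Let r_0, r_1, ... be signs with |sum_A r - sum_B r| = card A + card B for disjoint A, B
  (they span l_1 isometrically), and let f be L-Lipschitz into C(K). If S is closed and misses K^(j+1),
  then S meets K^(j) in a finite set, and by the pigeonhole principle f(a + r_n) and f(a + r_m) almost
  agree there for some n and m; hence f(a + r_n) and f(b + r_m) differ by little more than L |a - b| on
  a neighbourhood V of that finite set. Recursing on S - V, one finds x and y, sums of s + 1 new signs
  each, with |x - y| = 2(s+1) and |f x - f y| <= 2 s L + e.

  Upper bound. Following Kalton and Lancien, every separable metric space embeds into c_0 with
  distortion 2 + e. If x_0, x_1, ... is dense, z and w have distance d, and k is the first index for
  which the distances of z and w to x_0, ..., x_k sum up to less than about d/2, then z and w are
  separated by a 1-Lipschitz function with oscillation about d/2 which vanishes near x_0, ..., x_(k-1).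
  Up to discretisation, there are finitely many such functions for each k and each scale of d; this and
  the vanishing condition make them a map into c_0. Finally, c_0 embeds isometrically into C(K)
  for every infinite K.
*)

theory Submission
  imports Defs
begin

section \<open>Lipschitz maps into spaces of continuous functions on scattered compacta\<close>

lemma cb_deriv_iff: "x \<in> cb_deriv S \<longleftrightarrow> x \<in> S \<and> x islimpt S"
  by (auto simp: cb_deriv_def isolated_in_islimpt_iff)

lemma closed_cb_deriv:
  assumes "closed (S :: 'k::metric_space set)"
  shows "closed (cb_deriv S)"
proof -
  have "cb_deriv S = {x. x islimpt S}"
    using assms by (auto simp: cb_deriv_iff closed_limpt)
  then show ?thesis
    by (simp add: closed_limpts)
qed

lemma closed_cb_deriv_funpow: "closed ((cb_deriv ^^ n) (UNIV :: 'k::metric_space set))"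
  by (induction n) (auto intro: closed_cb_deriv)

text \<open>Otherwise \<open>S\<close>, being compact, would contain one of its own accumulation
  points, and that point would be a limit point of \<open>T\<close> as well.\<close>

lemma finite_if_disjoint_cb_deriv:
  fixes S T :: "'k::metric_space set"
  assumes "compact S" "S \<subseteq> T" "S \<inter> cb_deriv T = {}"
  shows "finite S"
proof (rule ccontr)
  assume "infinite S"
  then obtain x where "x \<in> S" "x islimpt S"
    using assms(1) unfolding compact_eq_Bolzano_Weierstrass by blast
  then have "x \<in> cb_deriv T"
    using assms(2) by (auto simp: cb_deriv_iff intro: islimpt_subset)
  with \<open>x \<in> S\<close> assms(3) show False by blast
qed

text \<open>Rounding values down to multiples of \<open>e\<close> leaves finitely many patterns on
  \<open>T\<close>, so two of the infinitely many indices from \<open>N\<close> on share a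
  pattern.\<close>

lemma pigeonhole_bounded_real_functions:
  fixes h :: "nat \<Rightarrow> 'k \<Rightarrow> real"
  assumes "finite T" "\<And>n k. k \<in> T \<Longrightarrow> \<bar>h n k\<bar> \<le> c" "e > 0"
  obtains m n where "m \<noteq> n" "m \<ge> N" "n \<ge> N" "\<And>k. k \<in> T \<Longrightarrow> \<bar>h m k - h n k\<bar> < e"
proof -
  define g where "g n = restrict (\<lambda>k. \<lfloor>h n k / e\<rfloor>) T" for n
  have "g ` {N..} \<subseteq> PiE T (\<lambda>_. {\<lfloor>-c/e\<rfloor>..\<lfloor>c/e\<rfloor>})"
    using assms(2,3)
    by (auto simp: g_def intro!: floor_mono divide_right_mono simp: abs_le_iff)
       (smt (verit) assms(2) divide_right_mono divide_minus_left floor_mono)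
  then have "finite (g ` {N..})"
    by (rule finite_subset) (auto intro!: finite_PiE assms(1))
  then have "\<not> inj_on g {N..}"
    using finite_imageD infinite_Ici by blast
  then obtain m n where mn: "m \<ge> N" "n \<ge> N" "m \<noteq> n" "g m = g n"
    by (auto simp: inj_on_def)
  have "\<bar>h m k - h n k\<bar> < e" if "k \<in> T" for k
  proof -
    have "\<lfloor>h m k / e\<rfloor> = \<lfloor>h n k / e\<rfloor>"
      using fun_cong[OF mn(4), of k] that by (simp add: g_def)
    then have "\<bar>h m k / e - h n k / e\<bar> < 1"
      by linarith
    then show ?thesis
      using \<open>e > 0\<close> by (simp add: field_simps abs_less_iff)
  qed
  with mn that show thesis by blast
qed

lemma dist_bcontfun_apply: "\<bar>apply_bcontfun u k - apply_bcontfun v k\<bar> \<le> dist u v"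
  using dist_bounded[of u k v] by (simp add: dist_real_def)

text \<open>Each step adds one sign to either side and moves the base points apart by at most 2. Two
  base points and an arbitrary closed \<open>S\<close> are needed because the induction continues
  from \<open>a + r n\<close> and \<open>b + r m\<close> on \<open>S - V\<close>.\<close>

lemma close_sums_over_scattered_set:
  fixes f :: "'b::real_normed_vector \<Rightarrow> ('k::metric_space \<Rightarrow>\<^sub>C real)" and r :: "nat \<Rightarrow> 'b"
  assumes K: "compact (UNIV :: 'k set)"
    and lip: "\<And>x y. x \<in> X \<Longrightarrow> y \<in> X \<Longrightarrow> dist (f x) (f y) \<le> L * dist x y"
    and L: "L \<ge> 0"
    and r: "\<And>n. norm (r n) \<le> 1"
    and X: "\<And>x n. x \<in> X \<Longrightarrow> x + r n \<in> X"
    and "closed S" "S \<inter> (cb_deriv ^^ j) UNIV = {}" "a \<in> X" "b \<in> X" "e > 0"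
  shows "\<exists>A B. finite A \<and> finite B \<and> card A = j \<and> card B = j \<and> A \<inter> B = {} \<and> A \<union> B \<subseteq> {N..} \<and>
    (\<forall>k\<in>S. \<bar>f (a + sum r A) k - f (b + sum r B) k\<bar> \<le> L * (dist a b + 2 * (real j - 1)) + e)"
  using assms(6-)
proof (induction j arbitrary: S a b N e)
  case 0
  \<comment> \<open>Here \<open>S\<close> is empty, so even the bound with \<open>real 0 - 1\<close>
    holds. This is the source of the gain of \<open>2 * L\<close> over the bound that the Lipschitz
    condition alone gives for the two sums.\<close>
  then show ?case by (intro exI[of _ "{}"]) auto
next
  case (Suc j)
  have sum_X: "x + sum r A \<in> X" if "x \<in> X" "finite A" for x A
    using that(2,1)
    by (induction A arbitrary: x rule: finite_induct) (auto simp: X simp flip: add.assoc)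
  have sum_norm: "norm (sum r A) \<le> card A" for A
    using sum_norm_le[of A r "\<lambda>_. 1"] r by simp
  define T where "T = S \<inter> (cb_deriv ^^ j) UNIV"
  have "compact T"
    using K Suc.prems(1) closed_cb_deriv_funpow[of j]
    by (metis T_def closed_Int compact_Int_closed inf_top_left)
  then have "finite T"
    by (rule finite_if_disjoint_cb_deriv[where T = "(cb_deriv ^^ j) UNIV"])
       (use Suc.prems(2) in \<open>auto simp: T_def\<close>)
  moreover have "\<bar>f (a + r n) k\<bar> \<le> norm (f a) + L" for n k
  proof -
    have "dist (f (a + r n)) (f a) \<le> L * norm (r n)"
      using lip[of "a + r n" a] X Suc.prems by (simp add: dist_norm)
    also have "\<dots> \<le> L"
      using r[of n] L by (simp add: mult_left_le)
    finally show ?thesis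
      using dist_bcontfun_apply[of "f (a + r n)" k "f a"] norm_bounded[of "f a" k] by simp
  qed
  ultimately obtain m n where mn: "m \<noteq> n" "m \<ge> N" "n \<ge> N"
      and close: "\<And>k. k \<in> T \<Longrightarrow> \<bar>f (a + r n) k - f (a + r m) k\<bar> < e"
    using pigeonhole_bounded_real_functions[of T "\<lambda>n k. f (a + r n) k" "norm (f a) + L" e N] \<open>e > 0\<close>
    by (smt (verit))
  \<comment> \<open>On \<open>V\<close> the signs \<open>r n\<close> and \<open>r m\<close> cost
    only \<open>e\<close>, which leaves room for \<open>L\<close> per later sign; off
    \<open>V\<close> the induction hypothesis applies.\<close>
  define V where "V = {k. \<bar>f (a + r n) k - f (b + r m) k\<bar> < e + L * dist a b}"
  have "open V"
    unfolding V_def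
    by (intro open_Collect_less continuous_intros continuous_on_apply_bcontfun)
  have "T \<subseteq> V"
  proof
    fix k assume "k \<in> T"
    have "dist (f (a + r m)) (f (b + r m)) \<le> L * dist a b"
      using lip[of "a + r m" "b + r m"] X Suc.prems by simp
    then show "k \<in> V"
      using close[OF \<open>k \<in> T\<close>] dist_bcontfun_apply[of "f (a + r m)" k "f (b + r m)"]
      by (simp add: V_def)
  qed
  have dab: "dist (a + r n) (b + r m) \<le> dist a b + 2"
    using dist_triangle_add[of a "r n" b "r m"] r[of n] r[of m]
      norm_triangle_ineq4[of "r n" "r m"] by (simp add: dist_norm[of "r n"])
  have "closed (S - V)" "(S - V) \<inter> (cb_deriv ^^ j) UNIV = {}"
    using closed_Diff[OF Suc.prems(1) \<open>open V\<close>] \<open>T \<subseteq> V\<close> unfolding T_def by blast+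
  \<comment> \<open>Starting at \<open>Suc (max m n)\<close> keeps all later indices different from
    \<open>m\<close> and \<open>n\<close>.\<close>
  from Suc.IH[OF this X[OF \<open>a \<in> X\<close>, of n] X[OF \<open>b \<in> X\<close>, of m] \<open>e > 0\<close>, of "Suc (max m n)"]
  obtain A B where AB: "finite A" "finite B" "card A = j" "card B = j" "A \<inter> B = {}"
      "A \<union> B \<subseteq> {Suc (max m n)..}"
    and bound: "\<forall>k\<in>S - V.
      \<bar>f (a + r n + sum r A) k - f (b + r m + sum r B) k\<bar>
        \<le> L * (dist (a + r n) (b + r m) + 2 * (real j - 1)) + e"
    by blast
  have new: "n \<notin> A" "m \<notin> A" "n \<notin> B" "m \<notin> B"
    using AB(6) by auto
  have "\<bar>f (a + r n + sum r A) k - f (b + r m + sum r B) k\<bar> \<le> L * (dist a b + 2 * real j) + e"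
    if "k \<in> S" for k
  proof (cases "k \<in> V")
    case True
    have near: "dist (f (x + sum r C)) (f x) \<le> L * real (card C)" if "x \<in> X" "finite C" for x C
    proof -
      have "dist (f (x + sum r C)) (f x) \<le> L * norm (sum r C)"
        using lip[OF sum_X[OF that] that(1)] by (simp add: dist_norm)
      also have "\<dots> \<le> L * real (card C)"
        using L sum_norm by (intro mult_left_mono)
      finally show ?thesis .
    qed
    have "\<bar>f (a + r n + sum r A) k - f (b + r m + sum r B) k\<bar>
      \<le> \<bar>f (a + r n) k - f (b + r m) k\<bar> + L * real j + L * real j"
      using near[OF X[OF \<open>a \<in> X\<close>] AB(1), of n, unfolded AB(3)]
        near[OF X[OF \<open>b \<in> X\<close>] AB(2), of m, unfolded AB(4)]
        dist_bcontfun_apply[of "f (a + r n + sum r A)" k "f (a + r n)"]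
        dist_bcontfun_apply[of "f (b + r m + sum r B)" k "f (b + r m)"] AB(3,4) by linarith
    then show ?thesis
      using True by (simp add: V_def algebra_simps)
  next
    case False
    have "L * (dist (a + r n) (b + r m) + 2 * (real j - 1)) \<le> L * (dist a b + 2 * real j)"
      using dab L by (intro mult_left_mono) auto
    then show ?thesis
      using bound False that by (smt (verit) DiffI)
  qed
  then show ?case
    using AB mn new
    by (intro exI[of _ "insert n A"] exI[of _ "insert m B"]) (auto simp: add.assoc)
qed

text \<open>With \<open>S\<close> the whole space, \<open>j = s + 1\<close> and both base points 0,
  two sums at distance at least 2(s+1) have images at distance at most 2sL + e; then e tends to
  0.\<close>

lemma lipschitz_constants_lower_bound:
  fixes f :: "'b::real_normed_vector \<Rightarrow> ('k::metric_space \<Rightarrow>\<^sub>C real)" and r :: "nat \<Rightarrow> 'b"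
  assumes K: "compact (UNIV :: 'k set)" "(cb_deriv ^^ Suc s) (UNIV :: 'k set) = {}"
    and lip: "\<And>x y. x \<in> X \<Longrightarrow> y \<in> X \<Longrightarrow> dist (f x) (f y) \<le> L * dist x y"
    and colip: "\<And>x y. x \<in> X \<Longrightarrow> y \<in> X \<Longrightarrow> dist x y \<le> l * dist (f x) (f y)"
    and L: "L \<ge> 0" "l \<ge> 0"
    and r: "\<And>n. norm (r n) \<le> 1"
    and sep: "\<And>A B. finite A \<Longrightarrow> finite B \<Longrightarrow> A \<inter> B = {} \<Longrightarrow>
      norm (sum r A - sum r B) \<ge> real (card A + card B)"
    and X: "0 \<in> X" "\<And>x n. x \<in> X \<Longrightarrow> x + r n \<in> X"
  shows "real s + 1 \<le> l * L * real s"
proof -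
  have "2 * (real s + 1) \<le> l * (L * (2 * real s) + e)" if "e > 0" for e
  proof -
    have "UNIV \<inter> (cb_deriv ^^ Suc s) (UNIV :: 'k set) = {}"
      using K(2) by simp
    from close_sums_over_scattered_set[where f = f and r = r and L = L and X = X and N = 0,
        OF K(1) lip L(1) r X(2) closed_UNIV this X(1) X(1) that]
    obtain A B where AB: "finite A" "finite B" "card A = Suc s" "card B = Suc s" "A \<inter> B = {}"
      and "\<forall>k\<in>UNIV. \<bar>f (0 + sum r A) k - f (0 + sum r B) k\<bar>
        \<le> L * (dist (0::'b) 0 + 2 * (real (Suc s) - 1)) + e"
      by blast
    then have bound: "\<And>k. \<bar>f (sum r A) k - f (sum r B) k\<bar> \<le> L * (2 * real s) + e"
      by simp
    have sum_X: "sum r C \<in> X" if "finite C" for C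
      using that by induction (auto simp: X add.commute[of "r _"])
    have "2 * (real s + 1) \<le> dist (sum r A) (sum r B)"
      using sep[OF AB(1,2,5)] AB(3,4) by (simp add: dist_norm)
    also have "\<dots> \<le> l * dist (f (sum r A)) (f (sum r B))"
      using AB sum_X by (intro colip)
    also have "\<dots> \<le> l * (L * (2 * real s) + e)"
      using bound L(2) by (intro mult_left_mono dist_bound) (auto simp: dist_real_def)
    finally show ?thesis .
  qed
  then have "2 * (real s + 1) \<le> 2 * (l * L * real s) + d" if "d > 0" for d
  proof -
    \<comment> \<open>Dividing by \<open>l + 1\<close> instead of \<open>l\<close> also covers
      \<open>l = 0\<close>.\<close>
    have "2 * (real s + 1) \<le> l * (L * (2 * real s) + d / (l + 1))"
      using L that \<open>\<And>e. e > 0 \<Longrightarrow> _\<close>[of "d / (l + 1)"] by simp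
    also have "\<dots> \<le> 2 * (l * L * real s) + d"
      using L that by (simp add: field_simps)
    finally show ?thesis .
  qed
  then show ?thesis
    using field_le_epsilon[of "2 * (real s + 1)" "2 * (l * L * real s)"] by simp
qed

section \<open>Embedding separable metric spaces into $c_0$\<close>

lemma geometric_scale:
  fixes b t :: real
  assumes "b > 1" "t > 0"
  obtains m :: int where "b powr m < t" "t \<le> b * b powr m"
proof
  \<comment> \<open>A ceiling minus one, not a floor, keeps the lower inequality strict when
    \<open>t\<close> is a power of \<open>b\<close>.\<close>
  define m where "m = \<lceil>log b t\<rceil> - 1"
  have "m < log b t" "log b t \<le> m + 1"
    unfolding m_def by linarith+
  then show "b powr m < t" "t \<le> b * b powr m"
    using assms by (simp_all add: less_log_iff log_le_iff powr_add mult.commute)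
qed

lemma finite_geometric_scales:
  fixes b :: real
  assumes "b > 1" "l > 0"
  shows "finite {m :: int. l \<le> b powr m \<and> b powr m \<le> r}"
proof (rule finite_subset)
  show "{m :: int. l \<le> b powr m \<and> b powr m \<le> r} \<subseteq> {\<lfloor>log b l\<rfloor>..\<lceil>log b r\<rceil>}"
  proof clarsimp
    fix m :: int
    assume m: "l \<le> b powr m" "b powr m \<le> r"
    have "r > 0"
      using m assms by (smt (verit))
    then have "log b l \<le> m" "m \<le> log b r"
      using m assms by (simp_all add: log_le_iff le_log_iff)
    then show "\<lfloor>log b l\<rfloor> \<le> m \<and> m \<le> \<lceil>log b r\<rceil>"
      by linarith
  qed
qed simp

section \<open>Truncated distance functions\<close>

context Metric_space
begin

text \<open>This is the positive part of s - dist(z, U). The inserted 0 truncates it and gives the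
  value 0 when \<open>U\<close> is empty.\<close>

definition hat :: "'a set \<Rightarrow> real \<Rightarrow> 'a \<Rightarrow> real" where
  "hat U s z = Sup (insert 0 ((\<lambda>u. s - d z u) ` U))"

lemma bdd_above_hat: "bdd_above (insert 0 ((\<lambda>u. s - d z u) ` U))"
proof (rule bdd_aboveI[of _ "max 0 s"])
  fix c assume "c \<in> insert 0 ((\<lambda>u. s - d z u) ` U)"
  then show "c \<le> max 0 s"
    using nonneg[of z] by (auto simp: le_max_iff_disj algebra_simps add_increasing)
qed

lemma hat_nonneg: "hat U s z \<ge> 0"
  unfolding hat_def by (rule cSup_upper[OF _ bdd_above_hat]) simp

lemma hat_ge: "u \<in> U \<Longrightarrow> s - d z u \<le> hat U s z"
  unfolding hat_def by (rule cSup_upper[OF _ bdd_above_hat]) simp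

lemma hat_le: "c \<ge> 0 \<Longrightarrow> (\<And>u. u \<in> U \<Longrightarrow> s - d z u \<le> c) \<Longrightarrow> hat U s z \<le> c"
  unfolding hat_def by (rule cSup_least) auto

lemma hat_le_height: "s \<ge> 0 \<Longrightarrow> hat U s z \<le> s"
  by (rule hat_le) auto

lemma hat_posE:
  assumes "hat U s z > 0"
  obtains u where "u \<in> U" "d z u < s"
proof -
  have "\<exists>u\<in>U. d z u < s"
    using hat_le[of 0 U s z] assms by force
  with that show thesis by blast
qed

lemma hat_lipschitz:
  assumes "U \<subseteq> M" "z \<in> M" "w \<in> M"
  shows "hat U s z - hat U s w \<le> d z w"
proof -
  have "hat U s z \<le> hat U s w + d z w"
  proof (rule hat_le)
    fix u assume "u \<in> U"
    then have "s - d w u \<le> hat U s w" "d w u \<le> d w z + d z u"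
      using hat_ge triangle assms by auto
    then show "s - d z u \<le> hat U s w + d z w"
      using commute[of w z] by linarith
  qed (simp add: hat_nonneg)
  then show ?thesis by simp
qed

text \<open>From s + t \<le> d u v \<le> d z u + d z w + d w v one gets (s - d z u) + (t - d w v)
  \<le> d z w; take suprema over u and v. Positivity of both hats ensures that the truncation at 0
  does not interfere.\<close>

lemma hat_add_le:
  assumes "U \<subseteq> M" "V \<subseteq> M" "z \<in> M" "w \<in> M"
    and sep: "\<And>u v. u \<in> U \<Longrightarrow> v \<in> V \<Longrightarrow> s + t \<le> d u v"
    and pos: "hat U s z > 0" "hat V t w > 0"
  shows "hat U s z + hat V t w \<le> d z w"
proof -
  obtain u0 v0 where 0: "u0 \<in> U" "d z u0 < s" "v0 \<in> V" "d w v0 < t"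
    using pos by (metis hat_posE)
  have main: "s - d z u \<le> d z w - (t - d w v)" if "u \<in> U" "v \<in> V" for u v
    using sep[OF that] triangle[of u z v] triangle[of z w v] that assms commute[of u z] by force
  \<comment> \<open>\<open>hat_le\<close> asks for a nonnegative bound; \<open>u0\<close> provides
    it here, and \<open>v0\<close> in the second supremum below.\<close>
  have "hat U s z \<le> d z w - (t - d w v)" if "v \<in> V" "t - d w v > 0" for v
    using main[OF 0(1)] main 0(2) that by (intro hat_le) force+
  then have "t - d w v \<le> d z w - hat U s z" if "v \<in> V" for v
    using that by (smt (verit) 0(3,4))
  then have "hat V t w \<le> d z w - hat U s z"
    using 0(3,4) by (intro hat_le) force+
  then show ?thesis by simp
qed

text \<open>In a one-sided difference only \<open>hat U s z\<close> and \<open>hat V t w\<close>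
  count positively. If both are positive, \<open>hat_add_le\<close> bounds their sum; otherwise a
  single 1-Lipschitz hat remains. So the constant is 1 and not 2.\<close>

lemma hat_diff_lipschitz:
  assumes "U \<subseteq> M" "V \<subseteq> M" "z \<in> M" "w \<in> M"
    and sep: "\<And>u v. u \<in> U \<Longrightarrow> v \<in> V \<Longrightarrow> s + t \<le> d u v"
  shows "\<bar>(hat U s z - hat V t z) - (hat U s w - hat V t w)\<bar> \<le> d z w"
proof -
  have "(hat U s z - hat V t z) - (hat U s w - hat V t w) \<le> d z w" if "z \<in> M" "w \<in> M" for z w
    using hat_lipschitz[OF assms(1) that, of s] hat_lipschitz[OF assms(2) that(2,1), of t]
      hat_add_le[OF assms(1,2) that sep] hat_nonneg[of U s z] hat_nonneg[of V t w]
      hat_nonneg[of U s w] hat_nonneg[of V t z] commute[of w z] by linarith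
  from this[of z w] this[of w z] show ?thesis
    using assms(3,4) commute[of w z] by (auto simp: abs_le_iff)
qed

section \<open>Functions separating points at one scale\<close>

text \<open>
  Points of the ball of radius \<open>a * u\<close> about \<open>x p\<close> which are at distance more than \<open>2 * N * u\<close> from
  some point of the ball of radius \<open>b * u\<close> about \<open>x q\<close>. The condition on \<open>i\<close> makes a hat of height
  \<open>i * u\<close> over this set vanish within distance \<open>u\<close> of \<open>x l\<close>, for all \<open>l < k\<close>.
\<close>

definition far_part :: "(nat \<Rightarrow> 'a) \<Rightarrow> nat \<Rightarrow> nat \<Rightarrow> real \<Rightarrow> nat \<Rightarrow> nat \<Rightarrow> nat \<Rightarrow> nat \<Rightarrow> nat \<Rightarrow> 'a set" where
  "far_part x N k u p q i a b = {z \<in> M. d z (x p) < a * u \<and>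
     (\<forall>l<k. 0 < i \<longrightarrow> (i + 1) * u \<le> d z (x l)) \<and>
     (\<exists>w\<in>M. d w (x q) < b * u \<and> 2 * N * u < d z w)}"

lemma far_part_subset: "far_part x N k u p q i a b \<subseteq> M"
  by (auto simp: far_part_def)

text \<open>The witness for \<open>z\<close> and the point \<open>v\<close> lie in one ball of
  radius b * u, so d z v > 2Nu - 2bu. By symmetry d z v > 2Nu - 2au, and the average of the two
  bounds is at least (N - 1)u.\<close>

lemma far_part_separation:
  assumes x: "range x \<subseteq> M" and z: "z \<in> far_part x N k u p q i a b" and v: "v \<in> far_part x N k u q p j b a"
    and "a + b \<le> N + 1" "u > 0"
  shows "(real N - 1) * u \<le> d z v"
proof -
  have M: "z \<in> M" "v \<in> M" "x p \<in> M" "x q \<in> M"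
    using z v x by (auto simp: far_part_def)
  obtain w where w: "w \<in> M" "d w (x q) < b * u" "2 * N * u < d z w"
    using z by (auto simp: far_part_def)
  obtain t where t: "t \<in> M" "d t (x p) < a * u" "2 * N * u < d v t"
    using v by (auto simp: far_part_def)
  have "d z (x p) < a * u" "d v (x q) < b * u"
    using z v by (auto simp: far_part_def)
  then have "d z v > 2 * N * u - 2 * (b * u)" "d z v > 2 * N * u - 2 * (a * u)"
    using w t M triangle[of z v w] triangle[of v "x q" w] triangle[of v z t] triangle[of z "x p" t]
      commute[of w "x q"] commute[of t "x p"] commute[of z v] by auto
  moreover have "(real a + real b) * u \<le> (N + 1) * u"
    using assms(4,5) by (intro mult_right_mono) auto
  ultimately show ?thesis
    by (simp add: algebra_simps)
qed

text \<open>\<open>p\<close>, \<open>q\<close> index the centres; \<open>i\<close>, \<open>j\<close>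
  are heights and \<open>a\<close>, \<open>b\<close> radii in units of \<open>u\<close>. The second
  hat has the roles of the centres exchanged, so that the two underlying sets are far apart.\<close>

definition level_fun ::
    "(nat \<Rightarrow> 'a) \<Rightarrow> nat \<Rightarrow> nat \<Rightarrow> real \<Rightarrow> nat \<times> nat \<times> nat \<times> nat \<times> nat \<times> nat \<Rightarrow> 'a \<Rightarrow> real" where
  "level_fun x N k u = (\<lambda>(p, q, i, j, a, b) z.
     hat (far_part x N k u p q i a b) (i * u) z - hat (far_part x N k u q p j b a) (j * u) z)"

text \<open>\<open>a + b \<le> N + 1\<close> yields a gap of (N - 1)u between the two sets, and
  \<open>i + j \<le> N - 1\<close> fits both hats into this gap.\<close>

definition level_params :: "nat \<Rightarrow> nat \<Rightarrow> (nat \<times> nat \<times> nat \<times> nat \<times> nat \<times> nat) set" where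
  "level_params N k = {(p, q, i, j, a, b). p \<le> k \<and> q \<le> k \<and> i + j \<le> N - 1 \<and> a + b \<le> N + 1}"

lemma finite_level_params: "finite (level_params N k)"
proof (rule finite_subset)
  show "level_params N k \<subseteq> {..k} \<times> {..k} \<times> {..N} \<times> {..N} \<times> {..N+1} \<times> {..N+1}"
    by (auto simp: level_params_def)
qed auto

lemma level_fun_lipschitz:
  assumes "range x \<subseteq> M" "u > 0" "N > 0" "c \<in> level_params N k" "z \<in> M" "w \<in> M"
  shows "\<bar>level_fun x N k u c z - level_fun x N k u c w\<bar> \<le> d z w"
proof -
  obtain p q i j a b where c: "c = (p, q, i, j, a, b)"
    by (metis prod_cases6)
  have ij: "i + j \<le> N - 1" "a + b \<le> N + 1"
    using assms(4) by (auto simp: c level_params_def)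
  have "(real i + real j) * u \<le> (real N - 1) * u"
    using ij assms(2,3) by (intro mult_right_mono) auto
  then have "i * u + j * u \<le> d z v"
    if "z \<in> far_part x N k u p q i a b" "v \<in> far_part x N k u q p j b a" for z v
    using far_part_separation[OF assms(1) that ij(2) assms(2)] by (simp add: algebra_simps)
  then show ?thesis
    unfolding c level_fun_def prod.case
    by (intro hat_diff_lipschitz far_part_subset assms)
qed

lemma level_fun_bound:
  assumes "u > 0" "c \<in> level_params N k"
  shows "\<bar>level_fun x N k u c z\<bar> \<le> N * u"
proof -
  obtain p q i j a b where c: "c = (p, q, i, j, a, b)"
    by (metis prod_cases6)
  have "i * u \<le> N * u" "j * u \<le> N * u"
    using assms by (auto simp: c level_params_def intro!: mult_right_mono)
  moreover have "0 \<le> i * u" "0 \<le> j * u"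
    using assms by auto
  ultimately show ?thesis
    using hat_nonneg[of "far_part x N k u p q i a b" "i * u" z]
      hat_nonneg[of "far_part x N k u q p j b a" "j * u" z]
      hat_le_height[of "i * u" "far_part x N k u p q i a b" z]
      hat_le_height[of "j * u" "far_part x N k u q p j b a" z]
    unfolding c level_fun_def prod.case by linarith
qed

text \<open>A positive hat puts \<open>z\<close> within i * u of a point whose distance to
  \<open>x l\<close> is at least (i + 1)u. It also forces \<open>i > 0\<close>, the case in which
  \<open>far_part\<close> imposes that distance.\<close>

lemma hat_far_part_support:
  assumes "range x \<subseteq> M" "z \<in> M" "hat (far_part x N k u p q i a b) (i * u) z > 0" "l < k"
  shows "d z (x l) > u"
proof -
  obtain v where v: "v \<in> far_part x N k u p q i a b" "d z v < i * u"
    using hat_posE[OF assms(3)] .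
  then have "i > 0"
    using nonneg[of z v] by (cases i) auto
  then have "(i + 1) * u \<le> d v (x l)"
    using v(1) \<open>l < k\<close> by (auto simp: far_part_def add.commute)
  moreover have "d v (x l) \<le> d z v + d z (x l)"
    using triangle[of v z "x l"] v(1) assms(1,2) commute[of v z] by (auto simp: far_part_def)
  ultimately show ?thesis
    using v(2) by (simp add: algebra_simps)
qed

lemma level_fun_support:
  assumes "range x \<subseteq> M" "z \<in> M" "level_fun x N k u c z \<noteq> 0" "l < k"
  shows "d z (x l) > u"
proof -
  obtain p q i j a b where c: "c = (p, q, i, j, a, b)"
    by (metis prod_cases6)
  have "hat (far_part x N k u p q i a b) (i * u) z > 0 \<or> hat (far_part x N k u q p j b a) (j * u) z > 0"
    using assms(3) hat_nonneg[of "far_part x N k u p q i a b" "i * u" z]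
      hat_nonneg[of "far_part x N k u q p j b a" "j * u" z]
    unfolding c level_fun_def prod.case by linarith
  then show ?thesis
    using hat_far_part_support[OF assms(1,2) _ assms(4)] by blast
qed

text \<open>At the first index \<open>k\<close> where the dense points approximate z and w well
  enough, x p and x q serve as centres. By minimality of \<open>k\<close> the earlier points are so
  far from z and w that hats of total height about d z w / 2 can still vanish near them.\<close>

lemma level_fun_separation:
  assumes x: "range x \<subseteq> M" and dense: "\<And>z e. z \<in> M \<Longrightarrow> e > 0 \<Longrightarrow> \<exists>n. d z (x n) < e"
    and N: "N > 2" and u: "u > 0" and M: "z \<in> M" "w \<in> M"
    and scale: "2 * N * u < d z w" "d z w \<le> (2 * N + 1) * u"
  obtains k c where "k > 0" "c \<in> level_params N k"
    "\<bar>level_fun x N k u c z - level_fun x N k u c w\<bar> \<ge> (real N - 6) * u"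
proof -
  \<comment> \<open>Slightly below 1/2, so that after rounding up to units of \<open>u\<close> the
    radii still satisfy \<open>a + b \<le> N + 1\<close>.\<close>
  define \<theta> where "\<theta> = 1 / 2 - 1 / N"
  have \<theta>: "0 < \<theta>" "\<theta> < 1" "\<theta> * (2 * N) = N - 2"
    using N by (auto simp: \<theta>_def field_simps)
  have xM: "x n \<in> M" for n
    using x by auto
  have pos: "d z w > 0"
    using scale u by (smt (verit) mult_nonneg_nonneg of_nat_0_le_iff)
  define P where "P k \<longleftrightarrow> (\<exists>p\<le>k. \<exists>q\<le>k. d z (x p) + d w (x q) < \<theta> * d z w)" for k
  define k where "k = (LEAST k. P k)"
  have "\<exists>k. P k"
  proof -
    obtain p q where "d z (x p) < \<theta> * d z w / 2" "d w (x q) < \<theta> * d z w / 2"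
      using dense[OF M(1), of "\<theta> * d z w / 2"] dense[OF M(2), of "\<theta> * d z w / 2"] \<theta> pos by auto
    then have "P (max p q)"
      unfolding P_def by (intro exI[of _ p] exI[of _ q] conjI) auto
    then show ?thesis by blast
  qed
  then have "P k"
    unfolding k_def by (rule LeastI_ex)
  have min: "\<not> P m" if "m < k" for m
    using that not_less_Least unfolding k_def by blast
  \<comment> \<open>A single point cannot be that close to both z and w. Hence \<open>k > 0\<close>,
    and there are earlier points over which to minimise in \<open>A\<close>.\<close>
  have "\<not> P 0"
  proof
    assume "P 0"
    then have "d z (x 0) + d w (x 0) < 1 * d z w"
      using \<theta> pos by (auto simp: P_def intro: less_trans mult_strict_right_mono)
    then show False
      using triangle[OF M(1) xM[of 0] M(2)] commute[of w "x 0"] by simp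
  qed
  with \<open>P k\<close> have "k > 0"
    by (cases k) auto
  obtain p q where pq: "p \<le> k" "q \<le> k" "d z (x p) + d w (x q) < \<theta> * d z w"
    using \<open>P k\<close> by (auto simp: P_def)
  have far: "\<theta> * d z w \<le> d z (x l) + d w (x l')" if "l < k" "l' < k" for l l'
  proof -
    have "l \<le> k - 1" "l' \<le> k - 1" "\<not> P (k - 1)"
      using min[of "k - 1"] that by auto
    then show ?thesis
      unfolding P_def by (metis not_le)
  qed
  define A where "A v = Min ((\<lambda>l. d v (x l)) ` {..<k})" for v
  have A_le: "A v \<le> d v (x l)" if "l < k" for v l
    unfolding A_def using that by (intro Min_le) auto
  have A_in: "\<exists>l<k. A v = d v (x l)" for v
  proof -
    have "A v \<in> (\<lambda>l. d v (x l)) ` {..<k}"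
      unfolding A_def using \<open>k > 0\<close> by (intro Min_in) auto
    then show ?thesis by auto
  qed
  have A_sum: "\<theta> * d z w \<le> A z + A w"
    using A_in[of z] A_in[of w] far by auto
  have A_nonneg: "A v \<ge> 0" for v
    using A_in[of v] nonneg by auto
  \<comment> \<open>The unit subtracted gives the \<open>i + 1\<close> required in
    \<open>far_part\<close>; if the result is 0, that condition is void. Rounding and subtraction
    together cost at most 2 units.\<close>
  define h where "h v = nat \<lfloor>A v / u\<rfloor> - 1" for v
  have h_ge: "real (h v) \<ge> A v / u - 2" for v
    unfolding h_def by linarith
  have h_le: "(real (h v) + 1) * u \<le> A v" if "h v > 0" for v
  proof -
    have "real (h v) + 1 \<le> A v / u"
      using that unfolding h_def by linarith
    then show ?thesis
      using u by (simp add: field_simps)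
  qed
  \<comment> \<open>Cutting the heights down one after the other makes their sum exactly
    \<open>min (h z + h w) (N - 1)\<close>.\<close>
  define i where "i = min (h z) (N - 1)"
  define j where "j = min (h w) (N - 1 - i)"
  have ij: "i + j \<le> N - 1" "i + j = min (h z + h w) (N - 1)"
    by (auto simp: i_def j_def)
  \<comment> \<open>Floor plus one, since the balls in \<open>far_part\<close> are open.\<close>
  define a where "a = nat \<lfloor>d z (x p) / u\<rfloor> + 1"
  define b where "b = nat \<lfloor>d w (x q) / u\<rfloor> + 1"
  have ab: "d z (x p) / u < a" "d w (x q) / u < b" "a \<le> d z (x p) / u + 1" "b \<le> d w (x q) / u + 1"
    using nonneg[of z "x p"] nonneg[of w "x q"] u by (simp_all add: a_def b_def) linarith+
  have "real a + real b < N + 2"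
  proof -
    have "\<theta> * d z w \<le> \<theta> * ((2 * N + 1) * u)"
      using scale \<theta> by (intro mult_left_mono) (auto simp: add.commute)
    also have "\<dots> = (\<theta> * (2 * N) + \<theta>) * u"
      by (simp add: algebra_simps)
    also have "\<dots> = (N - 2 + \<theta>) * u"
      by (simp only: \<theta>(3))
    finally have "d z (x p) + d w (x q) < (N - 2 + \<theta>) * u"
      using pq(3) by simp
    then have "d z (x p) / u + d w (x q) / u < N - 2 + \<theta>"
      using u by (simp add: field_simps)
    then show ?thesis
      using ab \<theta> N by (simp add: of_nat_diff)
  qed
  then have ab_le: "a + b \<le> N + 1"
    by linarith
  define c where "c = (p, q, i, j, a, b)"
  have "c \<in> level_params N k"
    using pq ij ab_le by (auto simp: c_def level_params_def)
  have less: "d z (x p) < a * u" "d w (x q) < b * u"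
    using ab u by (simp_all add: field_simps)
  have z_in: "z \<in> far_part x N k u p q i a b"
  proof -
    have "(i + 1) * u \<le> d z (x l)" if "l < k" "0 < i" for l
    proof -
      have "(real i + 1) * u \<le> (real (h z) + 1) * u"
        using u by (intro mult_right_mono) (auto simp: i_def)
      also have "\<dots> \<le> d z (x l)"
        using h_le[of z] A_le[OF that(1), of z] that(2) by (auto simp: i_def)
      finally show ?thesis by (simp add: add.commute)
    qed
    then show ?thesis
      using M less scale by (auto simp: far_part_def add.commute)
  qed
  have w_in: "w \<in> far_part x N k u q p j b a"
  proof -
    have "(j + 1) * u \<le> d w (x l)" if "l < k" "0 < j" for l
    proof -
      have "(real j + 1) * u \<le> (real (h w) + 1) * u"
        using u by (intro mult_right_mono) (auto simp: j_def)
      also have "\<dots> \<le> d w (x l)"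
        using h_le[of w] A_le[OF that(1), of w] that(2) by (auto simp: j_def)
      finally show ?thesis by (simp add: add.commute)
    qed
    then show ?thesis
      using M less scale commute[of z w] by (auto simp: far_part_def add.commute)
  qed
  have dist_ge: "(real i + real j) * u \<le> d v v'"
    if "v \<in> far_part x N k u p q i a b" "v' \<in> far_part x N k u q p j b a" for v v'
  proof -
    have "(real i + real j) * u \<le> (real N - 1) * u"
      using ij(1) N u by (intro mult_right_mono) auto
    then show ?thesis
      using far_part_separation[OF x that ab_le u] by simp
  qed
  \<comment> \<open>Each of z and w lies in its own set, where its hat has full height, and too far
    from the other set for the opposite hat to be positive.\<close>
  have "j * u \<le> d z v" if "v \<in> far_part x N k u q p j b a" for v
    using dist_ge[OF z_in that] u by (smt (verit) distrib_right mult_nonneg_nonneg of_nat_0_le_iff)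
  then have "hat (far_part x N k u q p j b a) (j * u) z \<le> 0"
    by (intro hat_le) auto
  moreover have "i * u \<le> d w v" if "v \<in> far_part x N k u p q i a b" for v
    using dist_ge[OF that w_in] u commute[of w v]
    by (smt (verit) distrib_right mult_nonneg_nonneg of_nat_0_le_iff)
  then have "hat (far_part x N k u p q i a b) (i * u) w \<le> 0"
    by (intro hat_le) auto
  moreover have "i * u \<le> hat (far_part x N k u p q i a b) (i * u) z"
    using hat_ge[OF z_in, of "i * u" z] M by simp
  moreover have "j * u \<le> hat (far_part x N k u q p j b a) (j * u) w"
    using hat_ge[OF w_in, of "j * u" w] M by simp
  ultimately have "(real i + real j) * u \<le> level_fun x N k u c z - level_fun x N k u c w"
    by (simp add: level_fun_def c_def algebra_simps)
  \<comment> \<open>The minima sum up to at least N - 2 units and rounding costs at most 2 for each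
    point; the cap N - 1 does no harm.\<close>
  moreover have "(real N - 6) * u \<le> (real i + real j) * u"
  proof (intro mult_right_mono)
    have "real (N - 2) * u = \<theta> * (2 * N * u)"
      using \<theta>(3) by (simp flip: mult.assoc)
    also have "\<dots> \<le> \<theta> * d z w"
      using scale \<theta> by (intro mult_left_mono) auto
    finally have "real (N - 2) * u \<le> \<theta> * d z w" .
    then have "real N - 2 \<le> A z / u + A w / u"
      using A_sum N u by (simp add: field_simps of_nat_diff)
    then have "real N - 6 \<le> real (h z) + real (h w)"
      using h_ge[of z] h_ge[of w] by linarith
    then show "real N - 6 \<le> real i + real j"
      using ij(2) by linarith
  qed (use u in simp)
  ultimately show thesis
    using that[OF \<open>k > 0\<close> \<open>c \<in> level_params N k\<close>] by linarith
qed

text \<open>The level functions of all scales are listed in one sequence. At a given z a value of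
  size \<delta> forces u \<ge> \<delta> / N; the support condition at \<open>x 0\<close>, available
  as \<open>k > 0\<close>, bounds u above; and a point \<open>x l\<close> within \<delta> / N of z
  forces k \<le> l. Only finitely many functions remain.\<close>

lemma c0_functions:
  fixes x :: "nat \<Rightarrow> 'a"
  assumes x: "range x \<subseteq> M" and dense: "\<And>z e. z \<in> M \<Longrightarrow> e > 0 \<Longrightarrow> \<exists>n. d z (x n) < e"
    and N: "N > 2"
  obtains g :: "nat \<Rightarrow> 'a \<Rightarrow> real"
  where "\<And>n z w. z \<in> M \<Longrightarrow> w \<in> M \<Longrightarrow> \<bar>g n z - g n w\<bar> \<le> d z w"
    and "\<And>z. z \<in> M \<Longrightarrow> (\<lambda>n. g n z) \<longlonglongrightarrow> 0"
    and "\<And>z w. z \<in> M \<Longrightarrow> w \<in> M \<Longrightarrow> z \<noteq> w \<Longrightarrow>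
      \<exists>n. (real N - 6) / (2 * real N + 1) * d z w \<le> \<bar>g n z - g n w\<bar>"
proof -
  \<comment> \<open>With this ratio (2N + 1) u_m = 2N u_(m+1), so the windows required by
    \<open>level_fun_separation\<close> cover all positive distances.\<close>
  define \<beta> where "\<beta> = 1 + 1 / (2 * real N)"
  define u where "u m = \<beta> powr real_of_int m / (2 * real N)" for m
  have \<beta>: "\<beta> > 1"
    using N by (simp add: \<beta>_def)
  have u: "u m > 0" "2 * real N * u m = \<beta> powr m" for m
    using N \<beta> by (simp_all add: u_def)
  define I where "I = {(m :: int, k, c). k > 0 \<and> c \<in> level_params N k}"
  define G where "G = (\<lambda>(m :: int, k, c). level_fun x N k (u m) c)"
  \<comment> \<open>\<open>from_nat\<close> may take one value at many n. The test lists each triple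
    only once, as convergence to 0 demands.\<close>
  define g where "g n = (if from_nat n \<in> I \<and> to_nat (from_nat n :: int \<times> nat \<times> nat \<times> nat \<times> nat \<times> nat \<times> nat \<times> nat) = n
    then G (from_nat n) else (\<lambda>_. 0))" for n
  have lip: "\<bar>g n z - g n w\<bar> \<le> d z w" if "z \<in> M" "w \<in> M" for n z w
    using that N u by (auto simp: g_def I_def G_def intro!: level_fun_lipschitz x)
  have lim: "(\<lambda>n. g n z) \<longlonglongrightarrow> 0" if z: "z \<in> M" for z
  proof (rule tendstoI)
    fix \<delta> :: real assume \<delta>: "\<delta> > 0"
    define S where "S = {m. 2 * \<delta> \<le> \<beta> powr real_of_int m \<and> \<beta> powr m \<le> 2 * real N * d z (x 0)}"
    have "\<delta> / N > 0"
      using \<delta> N by simp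
    then obtain l where l: "d z (x l) < \<delta> / N"
      using dense[OF z] by blast
    have "finite S"
      unfolding S_def using \<delta> \<beta> by (intro finite_geometric_scales) auto
    have "{t \<in> I. \<delta> \<le> \<bar>G t z\<bar>} \<subseteq> S \<times> (SIGMA k : {..l}. level_params N k)"
    proof
      fix t assume t: "t \<in> {t \<in> I. \<delta> \<le> \<bar>G t z\<bar>}"
      obtain m k c where mkc: "t = (m, k, c)"
        by (metis prod_cases3)
      have c: "k > 0" "c \<in> level_params N k" "\<delta> \<le> \<bar>level_fun x N k (u m) c z\<bar>"
        using t by (auto simp: I_def G_def mkc)
      then have supp: "u m < d z (x l)" if "l < k" for l
        using level_fun_support[OF x z _ that, of N "u m" c] \<delta> by auto
      have "\<delta> \<le> N * u m"
        using level_fun_bound[OF u(1) c(2), of x m z] c(3) by simp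
      then have "2 * \<delta> \<le> \<beta> powr m" "\<delta> / N \<le> u m"
        using u(2)[of m] N by (auto simp: field_simps)
      moreover have "\<beta> powr m \<le> 2 * real N * d z (x 0)"
        using supp[OF c(1)] N by (simp flip: u(2))
      moreover have "k \<le> l"
        using supp[of l] l \<open>\<delta> / N \<le> u m\<close> by force
      ultimately show "t \<in> S \<times> (SIGMA k : {..l}. level_params N k)"
        using c(2) by (auto simp: S_def mkc)
    qed
    then have "finite {t \<in> I. \<delta> \<le> \<bar>G t z\<bar>}"
      by (rule finite_subset) (intro finite_cartesian_product finite_SigmaI \<open>finite S\<close> finite_level_params finite_atMost)
    moreover have "{n. \<not> dist (g n z) 0 < \<delta>} \<subseteq> to_nat ` {t \<in> I. \<delta> \<le> \<bar>G t z\<bar>}"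
    proof
      fix n assume "n \<in> {n. \<not> dist (g n z) 0 < \<delta>}"
      then have "from_nat n \<in> {t \<in> I. \<delta> \<le> \<bar>G t z\<bar>}"
          "n = to_nat (from_nat n :: int \<times> nat \<times> nat \<times> nat \<times> nat \<times> nat \<times> nat \<times> nat)"
        using \<delta> by (auto simp: g_def split: if_splits)
      then show "n \<in> to_nat ` {t \<in> I. \<delta> \<le> \<bar>G t z\<bar>}"
        by blast
    qed
    ultimately have "finite {n. \<not> dist (g n z) 0 < \<delta>}"
      using finite_subset by blast
    then show "\<forall>\<^sub>F n in sequentially. dist (g n z) 0 < \<delta>"
      by (simp add: eventually_cofinite flip: cofinite_eq_sequentially)
  qed
  have sep: "\<exists>n. (real N - 6) / (2 * real N + 1) * d z w \<le> \<bar>g n z - g n w\<bar>"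
    if zw: "z \<in> M" "w \<in> M" "z \<noteq> w" for z w
  proof -
    have "d z w > 0"
      using zw by (simp add: mdist_pos_less)
    then obtain m where m: "\<beta> powr real_of_int m < d z w" "d z w \<le> \<beta> * \<beta> powr m"
      using geometric_scale[OF \<beta>] by blast
    have "\<beta> * \<beta> powr m = (2 * N + 1) * u m"
      using N by (simp add: u_def \<beta>_def field_simps)
    with m have scale: "2 * real N * u m < d z w" "d z w \<le> (2 * real N + 1) * u m"
      using u(2)[of m] by (auto simp: add.commute)
    then obtain k c where kc: "k > 0" "c \<in> level_params N k"
        "\<bar>level_fun x N k (u m) c z - level_fun x N k (u m) c w\<bar> \<ge> (real N - 6) * u m"
      using level_fun_separation[OF x dense N u(1) zw(1,2) scale] by blast
    have "\<exists>n. g n = level_fun x N k (u m) c"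
      using kc(1,2) by (intro exI[of _ "to_nat (m, k, c)"]) (simp add: g_def I_def G_def)
    then obtain n where n: "g n = level_fun x N k (u m) c" ..
    show ?thesis
    proof (cases "N \<ge> 6")
      case True
      have "(real N - 6) / (2 * real N + 1) * d z w \<le> (real N - 6) / (2 * real N + 1) * ((2 * real N + 1) * u m)"
        using scale True by (intro mult_left_mono) auto
      also have "\<dots> = (real N - 6) * u m"
        by (simp add: field_simps)
      finally show ?thesis
        using kc(3) n by (intro exI[of _ n]) simp
    next
      case False
      then have "(real N - 6) / (2 * real N + 1) * d z w \<le> 0"
        by (intro mult_nonpos_nonneg divide_nonpos_nonneg) auto
      then show ?thesis
        by (intro exI[of _ 0]) auto
    qed
  qed
  show thesis
    by (rule that[OF lip lim sep])
qed

end

section \<open>Embedding $c_0$ into spaces of continuous functions\<close>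

text \<open>The tents depend only on the distance to \<open>x0\<close> and live on annuli of
  relative width 1/4 around radii that more than halve, so the annuli are disjoint: 5/4 * 1/2 <
  3/4.\<close>

lemma tent_functions:
  fixes x0 :: "'k::metric_space"
  assumes "x0 islimpt UNIV"
  obtains \<phi> :: "nat \<Rightarrow> 'k \<Rightarrow> real" and y :: "nat \<Rightarrow> 'k"
  where "\<And>n. continuous_on UNIV (\<phi> n)" "\<And>n x. 0 \<le> \<phi> n x" "\<And>n x. \<phi> n x \<le> 1"
    "\<And>n. \<phi> n (y n) = 1" "\<And>m n x. \<phi> m x \<noteq> 0 \<Longrightarrow> \<phi> n x \<noteq> 0 \<Longrightarrow> m = n"
proof -
  have lim: "\<exists>x. x \<noteq> x0 \<and> dist x x0 < e" if "e > 0" for e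
    using assms that by (auto simp: islimpt_approachable)
  have "\<exists>y. \<forall>n. y n \<noteq> x0 \<and> dist (y (Suc n)) x0 < dist (y n) x0 / 2"
    using lim[of 1] lim[of "dist _ x0 / 2"] by (intro dependent_nat_choice) auto
  then obtain y where y: "\<And>n. y n \<noteq> x0" "\<And>n. dist (y (Suc n)) x0 < dist (y n) x0 / 2"
    by blast
  define \<rho> where "\<rho> n = dist (y n) x0" for n
  have pos: "\<rho> n > 0" for n
    using y by (simp add: \<rho>_def)
  have step: "\<rho> (Suc n) < \<rho> n / 2" for n
    using y by (simp add: \<rho>_def)
  have half: "\<rho> (n + Suc k) < \<rho> n / 2" for n k
  proof (induction k)
    case (Suc k)
    then show ?case
      using step[of "n + Suc k"] pos[of "n + Suc k"] by simp
  qed (use step in simp)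
  define \<phi> where "\<phi> n x = max 0 (1 - 4 * \<bar>dist x x0 - \<rho> n\<bar> / \<rho> n)" for n x
  have supp: "\<bar>dist x x0 - \<rho> n\<bar> < \<rho> n / 4" if "\<phi> n x \<noteq> 0" for n x
    using that pos[of n] by (auto simp: \<phi>_def max_def field_simps split: if_splits)
  have disj: False if "m < n" "\<phi> m x \<noteq> 0" "\<phi> n x \<noteq> 0" for m n x
  proof -
    obtain k where "n = m + Suc k"
      using \<open>m < n\<close> less_iff_Suc_add by auto
    then have "\<rho> n < \<rho> m / 2"
      using half[of m k] by simp
    then show False
      using supp[OF that(2)] supp[OF that(3)] pos[of m] by linarith
  qed
  show thesis
  proof (rule that)
    show "continuous_on UNIV (\<phi> n)" for n
      unfolding \<phi>_def using pos[of n] by (intro continuous_intros) auto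
    show "0 \<le> \<phi> n x" for n x
      by (simp add: \<phi>_def)
    show "\<phi> n x \<le> 1" for n x
      using pos[of n] by (auto simp: \<phi>_def)
    show "\<phi> n (y n) = 1" for n
      by (simp add: \<phi>_def \<rho>_def)
    show "m = n" if "\<phi> m x \<noteq> 0" "\<phi> n x \<noteq> 0" for m n x
      using disj that by (metis linorder_neqE_nat)
  qed
qed

text \<open>A null sequence a is sent to the sum of a_n \<phi>_n. At most one term is nonzero at
  each point, which bounds the norm above; the peaks \<open>y n\<close> recover the coordinates.
  Convergence of a to 0 makes the sum a uniform limit, hence continuous.\<close>

lemma c0_into_C:
  fixes x0 :: "'k::metric_space"
  assumes K: "compact (UNIV :: 'k set)" and "x0 islimpt UNIV"
  obtains \<Psi> :: "(nat \<Rightarrow> real) \<Rightarrow> ('k \<Rightarrow>\<^sub>C real)"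
  where "\<And>a b c. a \<longlonglongrightarrow> 0 \<Longrightarrow> b \<longlonglongrightarrow> 0 \<Longrightarrow> (\<And>n. \<bar>a n - b n\<bar> \<le> c) \<Longrightarrow> dist (\<Psi> a) (\<Psi> b) \<le> c"
    "\<And>a b n. a \<longlonglongrightarrow> 0 \<Longrightarrow> b \<longlonglongrightarrow> 0 \<Longrightarrow> \<bar>a n - b n\<bar> \<le> dist (\<Psi> a) (\<Psi> b)"
proof -
  obtain \<phi> :: "nat \<Rightarrow> 'k \<Rightarrow> real" and y :: "nat \<Rightarrow> 'k"
  where \<phi>: "\<And>n. continuous_on UNIV (\<phi> n)" "\<And>n x. 0 \<le> \<phi> n x" "\<And>n x. \<phi> n x \<le> 1"
    "\<And>n. \<phi> n (y n) = 1" and disj: "\<And>m n x. \<phi> m x \<noteq> 0 \<Longrightarrow> \<phi> n x \<noteq> 0 \<Longrightarrow> m = n"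
    using tent_functions[OF assms(2)] by blast
  define F where "F a x = (\<Sum>n | \<phi> n x \<noteq> 0. a n * \<phi> n x)" for a x
  have F_cases: "(\<exists>m. \<phi> m x \<noteq> 0 \<and> {n. \<phi> n x \<noteq> 0} = {m} \<and> (\<forall>a. F a x = a m * \<phi> m x)) \<or>
      ((\<forall>n. \<phi> n x = 0) \<and> (\<forall>a. F a x = 0))" for x
  proof (cases "\<exists>m. \<phi> m x \<noteq> 0")
    case True
    then obtain m where "\<phi> m x \<noteq> 0" ..
    then have "{n. \<phi> n x \<noteq> 0} = {m}"
      using disj by blast
    then show ?thesis
      using \<open>\<phi> m x \<noteq> 0\<close> by (auto simp: F_def)
  qed (simp add: F_def)
  have F_cont: "continuous_on UNIV (F a)" if a: "a \<longlonglongrightarrow> 0" for a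
  proof (rule uniform_limit_theorem)
    show "uniform_limit UNIV (\<lambda>N x. \<Sum>n<N. a n * \<phi> n x) (F a) sequentially"
    proof (rule uniform_limitI)
      fix e :: real assume "e > 0"
      then obtain N0 where N0: "\<And>n. n \<ge> N0 \<Longrightarrow> \<bar>a n\<bar> < e"
        using a by (auto simp: lim_sequentially)
      have "dist (\<Sum>n<N. a n * \<phi> n x) (F a x) < e" if "N \<ge> N0" for N x
        using F_cases[of x]
      proof (elim disjE exE conjE)
        fix m assume m: "\<phi> m x \<noteq> 0" "{n. \<phi> n x \<noteq> 0} = {m}" "\<forall>a. F a x = a m * \<phi> m x"
        have "(\<Sum>n<N. a n * \<phi> n x) = (\<Sum>n<N. if n = m then a m * \<phi> m x else 0)"
          using m(2) by (intro sum.cong) auto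
        also have "\<dots> = (if m < N then a m * \<phi> m x else 0)"
          by simp
        finally have S: "(\<Sum>n<N. a n * \<phi> n x) = (if m < N then a m * \<phi> m x else 0)" .
        show ?thesis
        proof (cases "m < N")
          case False
          have "\<bar>a m * \<phi> m x\<bar> \<le> \<bar>a m\<bar>"
            using \<phi>(2,3)[of m x] by (simp add: abs_mult mult_left_le)
          also have "\<dots> < e"
            using False that by (intro N0) simp
          finally show ?thesis
            using False m(3) S by (simp add: dist_real_def)
        qed (use m(3) S \<open>e > 0\<close> in simp)
      qed (use \<open>e > 0\<close> in simp)
      then show "\<forall>\<^sub>F N in sequentially. \<forall>x\<in>UNIV. dist (\<Sum>n<N. a n * \<phi> n x) (F a x) < e"
        by (auto simp: eventually_sequentially)
    qed
    show "\<forall>\<^sub>F N in sequentially. continuous_on UNIV (\<lambda>x. \<Sum>n<N. a n * \<phi> n x)"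
      by (intro always_eventually allI continuous_intros \<phi>)
  qed simp
  have F_bcontfun: "F a \<in> bcontfun" if "a \<longlonglongrightarrow> 0" for a
    using F_cont[OF that] compact_imp_bounded[OF compact_continuous_image[OF F_cont[OF that] K]]
    by (simp add: bcontfun_def)
  show thesis
  proof (rule that)
    fix a b :: "nat \<Rightarrow> real" and c
    assume ab: "a \<longlonglongrightarrow> 0" "b \<longlonglongrightarrow> 0" and c: "\<And>n. \<bar>a n - b n\<bar> \<le> c"
    have "c \<ge> 0"
      using c[of 0] by linarith
    have "\<bar>F a x - F b x\<bar> \<le> c" for x
      using F_cases[of x]
    proof (elim disjE exE conjE)
      fix m assume m: "\<phi> m x \<noteq> 0" "{n. \<phi> n x \<noteq> 0} = {m}" "\<forall>a. F a x = a m * \<phi> m x"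
      have "\<bar>a m * \<phi> m x - b m * \<phi> m x\<bar> = \<bar>a m - b m\<bar> * \<phi> m x"
        using \<phi>(2)[of m x] by (simp add: abs_mult flip: left_diff_distrib)
      also have "\<dots> \<le> \<bar>a m - b m\<bar>"
        using \<phi>(2,3)[of m x] by (simp add: mult_left_le)
      finally show ?thesis
        using c[of m] m(3) by simp
    qed (use \<open>c \<ge> 0\<close> in simp)
    then show "dist (Bcontfun (F a)) (Bcontfun (F b)) \<le> c"
      using ab by (intro dist_bound) (simp add: Bcontfun_inverse F_bcontfun dist_real_def)
  next
    fix a b :: "nat \<Rightarrow> real" and n
    assume ab: "a \<longlonglongrightarrow> 0" "b \<longlonglongrightarrow> 0"
    have "{m. \<phi> m (y n) \<noteq> 0} = {n}"
      using disj[of _ "y n" n] \<phi>(4)[of n] by auto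
    then have "F a (y n) = a n" for a
      using \<phi>(4)[of n] by (simp add: F_def)
    then show "\<bar>a n - b n\<bar> \<le> dist (Bcontfun (F a)) (Bcontfun (F b))"
      using dist_bounded[of "Bcontfun (F a)" "y n" "Bcontfun (F b)"] ab
      by (simp add: Bcontfun_inverse F_bcontfun dist_real_def)
  qed
qed

section \<open>A separable Banach space spanned by independent signs\<close>

lemma cring_real_ring: "cring real_ring"
  by (intro cringI abelian_groupI comm_monoidI)
     (auto simp: real_ring_def algebra_simps intro: exI[of _ "- _"])

text \<open>The class to be tested consists of metrics on \<open>'u\<close>, so a concrete closed
  subspace has to be moved there; all operations are pulled back along \<open>H\<close>.\<close>

lemma separable_banach_copy:
  fixes X D :: "'b::{real_normed_vector,complete_space} set" and H :: "'b \<Rightarrow> 'u"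
  assumes X: "closed X" "subspace X" and D: "countable D" "D \<subseteq> X" "X \<subseteq> closure D" and H: "inj_on H X"
  defines "M \<equiv> metric (H ` X, \<lambda>u v. dist (the_inv_into X H u) (the_inv_into X H v))"
  shows "M \<in> separable_banach_metrics" "mspace M = H ` X"
    "\<And>x y. x \<in> X \<Longrightarrow> y \<in> X \<Longrightarrow> mdist M (H x) (H y) = dist x y"
proof -
  have inv [simp]: "the_inv_into X H (H x) = x" if "x \<in> X" for x
    using H that by (rule the_inv_into_f_f)
  interpret Metric_space "H ` X" "\<lambda>u v. dist (the_inv_into X H u) (the_inv_into X H v)"
    by unfold_locales (auto simp: dist_commute intro: dist_triangle)
  show space: "mspace M = H ` X"
    by (simp add: M_def)
  have mdist: "mdist M u v = dist (the_inv_into X H u) (the_inv_into X H v)" for u v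
    by (simp add: M_def)
  then show "mdist M (H x) (H y) = dist x y" if "x \<in> X" "y \<in> X" for x y
    using that by simp
  have "mtopology closure_of (H ` D) = H ` X"
  proof -
    have "\<exists>y\<in>H ` D. y \<in> mball (H x) e" if xe: "x \<in> X" "e > 0" for x e
    proof -
      have "x \<in> closure D"
        using D(3) xe(1) by blast
      then obtain y where "y \<in> D" "dist y x < e"
        using xe(2) unfolding closure_approachable by blast
      then show ?thesis
        using D(2) xe by (intro bexI[of _ "H y"]) (auto simp: dist_commute subset_iff)
    qed
    then show ?thesis
      unfolding metric_closure_of by auto
  qed
  then have "separable_space (mtopology_of M)"
    unfolding separable_space_def M_def using D(1,2) by (intro exI[of _ "H ` D"]) auto
  moreover have "mcomplete"
    unfolding mcomplete_def
  proof (intro allI impI)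
    fix \<sigma> assume \<sigma>: "MCauchy \<sigma>"
    then have "\<sigma> n \<in> H ` X" for n
      by (auto simp: MCauchy_def)
    then have in_X: "the_inv_into X H (\<sigma> n) \<in> X" for n
      by (metis image_iff inv)
    have "Cauchy (\<lambda>n. the_inv_into X H (\<sigma> n))"
      using \<sigma> by (auto simp: MCauchy_def Cauchy_def)
    then obtain l where l: "(\<lambda>n. the_inv_into X H (\<sigma> n)) \<longlonglongrightarrow> l"
      using Cauchy_convergent convergent_def by blast
    have "l \<in> X"
      by (rule closed_sequentially[OF X(1) in_X l])
    with l have "limitin mtopology \<sigma> (H l) sequentially"
      using \<open>\<And>n. \<sigma> n \<in> H ` X\<close> by (auto simp: limit_metric_sequentially lim_sequentially)
    then show "\<exists>x. limitin mtopology \<sigma> x sequentially" ..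
  qed
  then have "mcomplete_of M"
    by (simp add: M_def)
  moreover have "\<exists>(V :: (real, 'u) module) nrm. real_normed_space V nrm \<and> carrier V = mspace M \<and>
        (\<forall>x \<in> carrier V. \<forall>y \<in> carrier V. mdist M x y = nrm (x \<ominus>\<^bsub>V\<^esub> y))"
  proof -
    define V :: "(real, 'u) module" where
      "V = \<lparr>carrier = H ` X, mult = \<lambda>u v. u, one = H 0, zero = H 0,
            add = \<lambda>u v. H (the_inv_into X H u + the_inv_into X H v), smult = \<lambda>a u. H (a *\<^sub>R the_inv_into X H u)\<rparr>"
    have V [simp]: "carrier V = H ` X" "zero V = H 0" "add V u v = H (the_inv_into X H u + the_inv_into X H v)"
        "smult V a u = H (a *\<^sub>R the_inv_into X H u)" for u v a
      by (simp_all add: V_def)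
    have R [simp]: "carrier real_ring = UNIV" "one real_ring = 1"
        "add real_ring a b = a + b" "mult real_ring a b = a * b" for a b
      by (simp_all add: real_ring_def)
    note mem = subspace_add[OF X(2)] subspace_scale[OF X(2)] subspace_0[OF X(2)] subspace_neg[OF X(2)]
    have group: "abelian_group V"
    proof (rule abelian_groupI)
      fix u assume "u \<in> carrier V"
      then show "\<exists>v\<in>carrier V. v \<oplus>\<^bsub>V\<^esub> u = \<zero>\<^bsub>V\<^esub>"
        by (intro bexI[of _ "H (- the_inv_into X H u)"]) (auto simp: mem)
    qed (auto simp: mem ac_simps)
    interpret V: abelian_group V by (rule group)
    have neg: "a_inv V (H x) = H (- x)" if "x \<in> X" for x
      by (rule V.minus_equality) (use that mem in auto)
    have "module real_ring V"
      by (rule moduleI[OF cring_real_ring group])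
         (auto simp: mem scaleR_add_left scaleR_add_right)
    then have "real_normed_space V (\<lambda>u. norm (the_inv_into X H u))"
      using inj_on_eq_iff[OF H] by (auto simp: mem real_normed_space_def real_normed_space_axioms_def
          intro: norm_triangle_ineq)
    moreover have "mdist M u v = norm (the_inv_into X H (u \<ominus>\<^bsub>V\<^esub> v))" if "u \<in> H ` X" "v \<in> H ` X" for u v
      using that neg mem(1)[OF _ mem(4)] by (auto simp: mem mdist a_minus_def dist_norm)
    ultimately show ?thesis
      using space by (intro exI[of _ V] exI[of _ "\<lambda>u. norm (the_inv_into X H u)"]) simp
  qed
  ultimately show "M \<in> separable_banach_metrics"
    by (simp add: separable_banach_metrics_def banach_metric_def)
qed

text \<open>\<open>D\<close> consists of the finite rational combinations of the r n, coded by
  lists. Approximating real scalars by rationals makes its closure a subspace.\<close>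

lemma separable_closed_subspace_containing:
  fixes r :: "nat \<Rightarrow> 'b::real_normed_vector"
  obtains X D where "closed X" "subspace X" "countable D" "D \<subseteq> X" "X \<subseteq> closure D" "range r \<subseteq> X"
proof -
  define c where "c = (\<lambda>qs :: (rat \<times> nat) list. \<Sum>(q, n)\<leftarrow>qs. of_rat q *\<^sub>R r n)"
  define D where "D = range c"
  have add: "x + y \<in> D" if xy: "x \<in> D" "y \<in> D" for x y
  proof -
    obtain ps qs where "x = c ps" "y = c qs"
      using xy by (auto simp: D_def)
    then have "x + y = c (ps @ qs)"
      by (simp add: c_def)
    then show ?thesis
      by (simp add: D_def)
  qed
  have scale: "of_rat q *\<^sub>R x \<in> D" if x: "x \<in> D" for q x
  proof -
    obtain qs where qs: "x = c qs"
      using x by (auto simp: D_def)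
    have "of_rat q *\<^sub>R c qs = c (map (\<lambda>(p, n). (q * p, n)) qs)" for qs
      by (induction qs) (auto simp: c_def scaleR_add_right of_rat_mult)
    then show ?thesis
      using qs by (simp add: D_def)
  qed
  have "subspace (closure D)"
  proof (rule subspaceI)
    have "c [] \<in> D"
      by (simp add: D_def)
    then show "0 \<in> closure D"
      using closure_subset by (auto simp: c_def)
  next
    fix x y assume "x \<in> closure D" "y \<in> closure D"
    then obtain f g where "\<And>n. f n \<in> D" "f \<longlonglongrightarrow> x" "\<And>n. g n \<in> D" "g \<longlonglongrightarrow> y"
      by (auto simp: closure_sequential)
    then have "\<And>n. f n + g n \<in> D" "(\<lambda>n. f n + g n) \<longlonglongrightarrow> x + y"
      by (auto intro: add tendsto_add)
    then show "x + y \<in> closure D"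
      unfolding closure_sequential by (intro exI[of _ "\<lambda>n. f n + g n"]) simp
  next
    fix a :: real and x assume "x \<in> closure D"
    then obtain f where f: "\<And>n. f n \<in> D" "f \<longlonglongrightarrow> x"
      by (auto simp: closure_sequential)
    have "\<exists>q. \<bar>of_rat q - a\<bar> < inverse (Suc n)" for n
    proof -
      have "a < a + inverse (Suc n)"
        by simp
      from of_rat_dense[OF this] obtain q where "a < of_rat q" "of_rat q < a + inverse (Suc n)"
        by blast
      then show ?thesis
        by (intro exI[of _ q]) auto
    qed
    then obtain q where q: "\<And>n. \<bar>of_rat (q n) - a\<bar> < inverse (Suc n)"
      by metis
    have "(\<lambda>n. of_rat (q n) - a) \<longlonglongrightarrow> 0"
      by (rule tendsto_rabs_zero_cancel, rule tendsto_sandwich[OF _ _ tendsto_const LIMSEQ_inverse_real_of_nat])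
         (auto intro!: always_eventually less_imp_le q simp del: of_nat_Suc)
    then have "(\<lambda>n. of_rat (q n)) \<longlonglongrightarrow> a"
      by (simp add: LIM_zero_iff)
    then have "(\<lambda>n. of_rat (q n) *\<^sub>R f n) \<longlonglongrightarrow> a *\<^sub>R x"
      using f(2) by (rule tendsto_scaleR)
    then show "a *\<^sub>R x \<in> closure D"
      using f(1) scale by (auto simp: closure_sequential intro!: exI[of _ "\<lambda>n. of_rat (q n) *\<^sub>R f n"])
  qed
  moreover have "r n \<in> D" for n
  proof -
    have "c [(1, n)] \<in> D"
      by (simp add: D_def)
    then show ?thesis
      by (simp add: c_def)
  qed
  then have "range r \<subseteq> closure D"
    using closure_subset by blast
  moreover have "countable D"
    by (simp add: D_def)
  ultimately show thesis
    using that[of "closure D" D] closure_subset by blast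
qed

text \<open>A point is coded by the set of balls with centre in \<open>D\<close> and rational radius
  that contain it. A small ball around a nearby centre tells two points apart, and sets of naturals
  inject into the reals.\<close>

lemma separable_injects_into_real:
  fixes X D :: "'b::metric_space set"
  assumes "countable D" "X \<subseteq> closure D"
  obtains h :: "'b \<Rightarrow> real" where "inj_on h X"
proof -
  define g where "g x = to_nat_on (D \<times> UNIV) ` {(y, q :: rat). y \<in> D \<and> dist y x < of_rat q}" for x
  have inj: "inj_on (to_nat_on (D \<times> (UNIV :: rat set))) (D \<times> UNIV)"
    using assms(1) by (intro inj_on_to_nat_on) auto
  have "inj_on g X"
  proof (rule inj_onI, rule ccontr)
    fix x z assume xz: "x \<in> X" "z \<in> X" "g x = g z" "x \<noteq> z"
    then have eq: "{(y, q :: rat). y \<in> D \<and> dist y x < of_rat q} = {(y, q). y \<in> D \<and> dist y z < of_rat q}"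
      unfolding g_def by (subst (asm) inj_on_image_eq_iff[OF inj]) auto
    obtain y where y: "y \<in> D" "dist y x < dist x z / 2"
      using assms(2) xz(1,4) closure_approachable[of x D] by (metis subsetD half_gt_zero zero_less_dist_iff)
    obtain q where q: "dist y x < of_rat q" "of_rat q < dist x z / 2"
      using of_rat_dense[OF y(2)] by blast
    then have "dist y z < of_rat q"
      using eq y(1) by blast
    then show False
      using q dist_triangle2[of x z y] by (simp add: dist_commute)
  qed
  moreover obtain k :: "nat set \<Rightarrow> real" where "inj k"
    using nat_sets_eqpoll_reals by (auto simp: eqpoll_def bij_betw_def)
  ultimately have "inj_on (k \<circ> g) X"
    by (auto intro: comp_inj_on inj_on_subset)
  with that show thesis .
qed

text \<open>Coordinates of real sequences, clipped to be bounded. Sequences with entries 1 and -1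
  realise all sign patterns at once, which gives the l_1 behaviour.\<close>

definition sign_fun :: "nat \<Rightarrow> ((nat \<Rightarrow> real) \<Rightarrow>\<^sub>C real)" where
  "sign_fun n = Bcontfun (\<lambda>t. max (- 1) (min 1 (t n)))"

lemma apply_sign_fun: "apply_bcontfun (sign_fun n) t = max (- 1) (min 1 (t n))"
proof -
  have "(\<lambda>t. max (- 1) (min 1 (t n)) :: real) \<in> bcontfun"
    by (rule bcontfun_normI[where b = 1]) (auto intro!: continuous_intros continuous_on_product_coordinates)
  then show ?thesis
    by (simp add: sign_fun_def Bcontfun_inverse)
qed

lemma norm_sign_fun: "norm (sign_fun n) \<le> 1"
  by (rule norm_bound) (auto simp: apply_sign_fun abs_le_iff)

lemma apply_bcontfun_sum: "apply_bcontfun (sum f A) t = (\<Sum>a\<in>A. apply_bcontfun (f a) t)"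
  by (induction A rule: infinite_finite_induct) (auto simp: plus_bcontfun.rep_eq)

lemma norm_sign_fun_sums:
  assumes "finite A" "finite B" "A \<inter> B = {}"
  shows "norm (sum sign_fun A - sum sign_fun B) \<ge> real (card A + card B)"
proof -
  define t where "t n = (if n \<in> A then 1 else - 1 :: real)" for n
  have "(\<Sum>n\<in>A. apply_bcontfun (sign_fun n) t) = (\<Sum>n\<in>A. 1)"
    by (intro sum.cong) (auto simp: apply_sign_fun t_def)
  moreover have "(\<Sum>n\<in>B. apply_bcontfun (sign_fun n) t) = (\<Sum>n\<in>B. - 1)"
    using assms(3) by (intro sum.cong) (auto simp: apply_sign_fun t_def)
  ultimately have "apply_bcontfun (sum sign_fun A - sum sign_fun B) t = real (card A + card B)"
    by (simp add: minus_bcontfun.rep_eq apply_bcontfun_sum)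
  then show ?thesis
    using norm_bounded[of "sum sign_fun A - sum sign_fun B" t] by simp
qed

section \<open>Distortion estimates\<close>

text \<open>The first fact feeds the lower bound; the second provides the limit point at which c_0
  is embedded.\<close>

lemma cb_deriv_finite_order:
  assumes "cb_order (UNIV :: 'k::topological_space set) = enat s" "s \<ge> 1"
  shows "(cb_deriv ^^ Suc s) (UNIV :: 'k set) = {}" "cb_deriv (UNIV :: 'k set) \<noteq> {}"
proof -
  show "(cb_deriv ^^ Suc s) (UNIV :: 'k set) = {}"
  proof (rule ccontr)
    assume "(cb_deriv ^^ Suc s) (UNIV :: 'k set) \<noteq> {}"
    then have "cb_derivative (UNIV :: 'k set) (enat (Suc s)) \<noteq> {}"
      by (simp add: cb_derivative_def)
    then have "enat (Suc s) \<le> cb_order (UNIV :: 'k set)"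
      unfolding cb_order_def by (intro Sup_upper) simp
    then show False
      using assms by simp
  qed
  show "cb_deriv (UNIV :: 'k set) \<noteq> {}"
  proof
    assume empty: "cb_deriv (UNIV :: 'k set) = {}"
    have "cb_deriv ({} :: 'k set) = {}"
      by (auto simp: cb_deriv_def)
    with empty have iter: "(cb_deriv ^^ Suc n) (UNIV :: 'k set) = {}" for n
      by (induction n) auto
    have "\<alpha> = 0" if "cb_derivative (UNIV :: 'k set) \<alpha> \<noteq> {}" for \<alpha>
    proof (cases \<alpha>)
      case (enat n)
      then show ?thesis
        using that iter by (cases n) (auto simp: cb_derivative_def enat_0)
    next
      case infinity
      then have "cb_derivative (UNIV :: 'k set) \<alpha> \<subseteq> (cb_deriv ^^ Suc 0) UNIV"
        unfolding cb_derivative_def by (simp only: enat.case) (rule INF_lower, simp)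
      then show ?thesis
        using that iter by blast
    qed
    then have "cb_order (UNIV :: 'k set) \<le> 0"
      unfolding cb_order_def by (intro Sup_least) force
    then show False
      using assms by (simp add: enat_0_iff)
  qed
qed

lemma distortion_le:
  assumes upper: "\<And>z w. z \<in> mspace M \<Longrightarrow> w \<in> mspace M \<Longrightarrow> mdist N (f z) (f w) \<le> mdist M z w"
    and lower: "\<And>z w. z \<in> mspace M \<Longrightarrow> w \<in> mspace M \<Longrightarrow> c * mdist M z w \<le> mdist N (f z) (f w)"
    and "c > 0"
  shows "distortion M N f \<le> ennreal (1 / c)"
proof -
  have pos: "mdist M z w > 0" if "z \<in> mspace M" "w \<in> mspace M" "z \<noteq> w" for z w
    using that by (simp add: less_le)
  have "(SUP (x, y) \<in> {(x, y). x \<in> mspace M \<and> y \<in> mspace M \<and> x \<noteq> y}.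
        ennreal (mdist N (f x) (f y)) / ennreal (mdist M x y)) \<le> 1"
  proof (rule SUP_least, clarify)
    fix z w assume zw: "z \<in> mspace M" "w \<in> mspace M" "z \<noteq> w"
    then show "ennreal (mdist N (f z) (f w)) / ennreal (mdist M z w) \<le> 1"
      using upper[OF zw(1,2)] pos[OF zw] by (simp add: divide_ennreal flip: ennreal_1)
  qed
  moreover have "(SUP (x, y) \<in> {(x, y). x \<in> mspace M \<and> y \<in> mspace M \<and> x \<noteq> y}.
        ennreal (mdist M x y) / ennreal (mdist N (f x) (f y))) \<le> ennreal (1 / c)"
  proof (rule SUP_least, clarify)
    fix z w assume zw: "z \<in> mspace M" "w \<in> mspace M" "z \<noteq> w"
    \<comment> \<open>With a positive divisor the quotient in \<open>ennreal\<close> is the real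
      one.\<close>
    have "0 < c * mdist M z w"
      using pos[OF zw] \<open>c > 0\<close> by simp
    also have "\<dots> \<le> mdist N (f z) (f w)"
      using lower[OF zw(1,2)] .
    finally show "ennreal (mdist M z w) / ennreal (mdist N (f z) (f w)) \<le> ennreal (1 / c)"
      using lower[OF zw(1,2)] \<open>c > 0\<close> by (simp add: divide_ennreal field_simps)
  qed
  ultimately have "distortion M N f \<le> 1 * ennreal (1 / c)"
    unfolding distortion_def by (intro mult_mono) auto
  then show ?thesis by simp
qed

lemma embedding_const_separable_le_2:
  fixes M :: "'u metric" and x0 :: "'k::metric_space"
  assumes K: "compact (UNIV :: 'k set)" and x0: "x0 islimpt UNIV"
    and sep: "separable_space (mtopology_of M)"
  shows "embedding_const (C_metric :: ('k \<Rightarrow>\<^sub>C real) metric) M \<le> 2"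
proof (cases "mspace M = {}")
  case True
  \<comment> \<open>Suprema over no pairs are 0 in \<open>ennreal\<close>. The empty space is
    treated apart because it has no dense sequence.\<close>
  then have "distortion M (C_metric :: ('k \<Rightarrow>\<^sub>C real) metric) f = 0" for f
    by (simp add: distortion_def bot_ennreal)
  then have "embedding_const (C_metric :: ('k \<Rightarrow>\<^sub>C real) metric) M \<le> 0"
    unfolding embedding_const_def using True
    by (intro INF_lower2[of "\<lambda>_. 0"]) (auto simp: bilipschitz_embedding_def)
  then show ?thesis by simp
next
  case False
  interpret Metric_space "mspace M" "mdist M" by simp
  obtain C where C: "countable C" "C \<subseteq> mspace M" "mtopology_of M closure_of C = mspace M"
    using sep by (auto simp: separable_space_def)
  with False have "C \<noteq> {}"
    by auto
  define x where "x = from_nat_into C"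
  have range: "range x = C"
    using C(1) \<open>C \<noteq> {}\<close> by (simp add: x_def range_from_nat_into)
  have x: "range x \<subseteq> mspace M"
    using range C(2) by simp
  have dense: "\<exists>n. mdist M z (x n) < e" if "z \<in> mspace M" "e > 0" for z e
  proof -
    have "\<exists>y\<in>C. y \<in> mball z e"
      using C(3) that by (auto simp: mtopology_of_def metric_closure_of)
    then show ?thesis
      using range by (metis imageE in_mball)
  qed
  obtain \<Psi> :: "(nat \<Rightarrow> real) \<Rightarrow> ('k \<Rightarrow>\<^sub>C real)"
    where \<Psi>: "\<And>a b c. a \<longlonglongrightarrow> 0 \<Longrightarrow> b \<longlonglongrightarrow> 0 \<Longrightarrow> (\<And>n. \<bar>a n - b n\<bar> \<le> c) \<Longrightarrow> dist (\<Psi> a) (\<Psi> b) \<le> c"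
      "\<And>a b n. a \<longlonglongrightarrow> 0 \<Longrightarrow> b \<longlonglongrightarrow> 0 \<Longrightarrow> \<bar>a n - b n\<bar> \<le> dist (\<Psi> a) (\<Psi> b)"
    using c0_into_C[OF K x0] by blast
  have bound: "embedding_const (C_metric :: ('k \<Rightarrow>\<^sub>C real) metric) M \<le> ennreal (2 + 13 * inverse (Suc n))" for n
  proof -
    \<comment> \<open>For N = n + 7 the separation constant is (n + 1) / (2n + 15), whose inverse 2
      + 13 / (n + 1) tends to 2.\<close>
    have n: "2 < n + 7"
      by simp
    define c where "c = (real (n + 7) - 6) / (2 * real (n + 7) + 1)"
    obtain g :: "nat \<Rightarrow> 'u \<Rightarrow> real"
      where g: "\<And>i z w. z \<in> mspace M \<Longrightarrow> w \<in> mspace M \<Longrightarrow> \<bar>g i z - g i w\<bar> \<le> mdist M z w"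
        "\<And>z. z \<in> mspace M \<Longrightarrow> (\<lambda>i. g i z) \<longlonglongrightarrow> 0"
        "\<And>z w. z \<in> mspace M \<Longrightarrow> w \<in> mspace M \<Longrightarrow> z \<noteq> w \<Longrightarrow> \<exists>i. c * mdist M z w \<le> \<bar>g i z - g i w\<bar>"
      by (rule c0_functions[OF x _ n, folded c_def]) (erule (1) dense, rule that)
    define f where "f z = \<Psi> (\<lambda>i. g i z)" for z
    have "c > 0"
      by (simp add: c_def)
    have upper: "dist (f z) (f w) \<le> mdist M z w" if "z \<in> mspace M" "w \<in> mspace M" for z w
      unfolding f_def using that by (intro \<Psi>(1) g)
    have lower: "c * mdist M z w \<le> dist (f z) (f w)" if zw: "z \<in> mspace M" "w \<in> mspace M" for z w
    proof (cases "z = w")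
      case False
      then obtain i where "c * mdist M z w \<le> \<bar>g i z - g i w\<bar>"
        using g(3)[OF zw] by blast
      also have "\<dots> \<le> dist (f z) (f w)"
        unfolding f_def using zw by (intro \<Psi>(2) g)
      finally show ?thesis .
    qed (use zw in simp)
    have "distortion M C_metric f \<le> ennreal (1 / c)"
      using upper lower \<open>c > 0\<close> by (intro distortion_le) auto
    moreover have "inj_on f (mspace M)"
    proof (rule inj_onI, rule ccontr)
      fix z w assume zw: "z \<in> mspace M" "w \<in> mspace M" "f z = f w" "z \<noteq> w"
      have "mdist M z w > 0"
        using zw by (intro mdist_pos_less)
      then have "c * mdist M z w > 0"
        using \<open>c > 0\<close> by simp
      then show False
        using lower[OF zw(1,2)] zw(3) by simp
    qed
    ultimately have "embedding_const (C_metric :: ('k \<Rightarrow>\<^sub>C real) metric) M \<le> ennreal (1 / c)"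
      unfolding embedding_const_def
      by (intro INF_lower2[of f]) (auto simp: bilipschitz_embedding_def intro: le_less_trans[OF _ ennreal_less_top])
    also have "1 / c = 2 + 13 * inverse (Suc n)"
      by (simp add: c_def field_simps)
    finally show ?thesis .
  qed
  have "(\<lambda>n. 2 + 13 * inverse (real (Suc n))) \<longlonglongrightarrow> 2 + 13 * 0"
    by (intro tendsto_intros LIMSEQ_inverse_real_of_nat)
  then have "(\<lambda>n. ennreal (2 + 13 * inverse (real (Suc n)))) \<longlonglongrightarrow> ennreal 2"
    by (intro tendsto_ennrealI) simp
  then have "embedding_const (C_metric :: ('k \<Rightarrow>\<^sub>C real) metric) M \<le> ennreal 2"
    using bound by (intro LIMSEQ_le_const) auto
  then show ?thesis by simp
qed

lemma distortion_lower_bound: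
  fixes F :: "'u \<Rightarrow> ('k::metric_space \<Rightarrow>\<^sub>C real)" and H :: "'b::real_normed_vector \<Rightarrow> 'u" and r :: "nat \<Rightarrow> 'b"
  assumes K: "compact (UNIV :: 'k set)" "(cb_deriv ^^ Suc s) (UNIV :: 'k set) = {}" "s \<ge> 1"
    and M: "mspace M = H ` X" "\<And>x y. x \<in> X \<Longrightarrow> y \<in> X \<Longrightarrow> mdist M (H x) (H y) = dist x y" "inj_on H X"
    and r: "\<And>n. norm (r n) \<le> 1"
    and sep: "\<And>A B. finite A \<Longrightarrow> finite B \<Longrightarrow> A \<inter> B = {} \<Longrightarrow>
      norm (sum r A - sum r B) \<ge> real (card A + card B)"
    and X: "0 \<in> X" "\<And>x n. x \<in> X \<Longrightarrow> x + r n \<in> X"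
    and F: "bilipschitz_embedding M C_metric F"
  shows "ennreal ((real s + 1) / real s) \<le> distortion M C_metric F"
proof -
  define P where "P = {(x, y). x \<in> mspace M \<and> y \<in> mspace M \<and> x \<noteq> y}"
  define S1 where "S1 = (SUP (x, y) \<in> P. ennreal (dist (F x) (F y)) / ennreal (mdist M x y))"
  define S2 where "S2 = (SUP (x, y) \<in> P. ennreal (mdist M x y) / ennreal (dist (F x) (F y)))"
  have D: "distortion M C_metric F = S1 * S2"
    by (simp add: distortion_def S1_def S2_def P_def)
  have inj: "inj_on F (mspace M)"
    using F by (simp add: bilipschitz_embedding_def)
  have P: "(H x, H y) \<in> P \<and> dist (F (H x)) (F (H y)) > 0 \<and> mdist M (H x) (H y) = dist x y"
    if "x \<in> X" "y \<in> X" "x \<noteq> y" for x y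
    using that M inj by (auto simp: P_def dest: inj_onD)
  have S1: "ennreal (dist (F (H x)) (F (H y)) / dist x y) \<le> S1" if "x \<in> X" "y \<in> X" "x \<noteq> y" for x y
    unfolding S1_def using P[OF that] that
    by (intro SUP_upper2[of "(H x, H y)"]) (auto simp: divide_ennreal)
  have S2: "ennreal (dist x y / dist (F (H x)) (F (H y))) \<le> S2" if "x \<in> X" "y \<in> X" "x \<noteq> y" for x y
    unfolding S2_def using P[OF that] that
    by (intro SUP_upper2[of "(H x, H y)"]) (auto simp: divide_ennreal)
  \<comment> \<open>The distinct points 0 and \<open>r 0\<close> make both suprema positive, so that
    a finite product has finite factors; these factors are the constants \<open>L\<close> and
    \<open>l\<close> below.\<close>
  have "norm (r 0) \<ge> 1"
    using sep[of "{0}" "{}"] by simp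
  then have "r 0 \<noteq> 0"
    by auto
  moreover have "r 0 \<in> X"
    using X(2)[OF X(1), of 0] by simp
  ultimately have r0: "r 0 \<in> X" "0 \<in> X" "r 0 \<noteq> 0"
    using X(1) by auto
  have "S1 > 0"
    by (rule less_le_trans[OF _ S1[OF r0]]) (use P[OF r0] r0 in simp)
  moreover have "S2 > 0"
    by (rule less_le_trans[OF _ S2[OF r0]]) (use P[OF r0] r0 in simp)
  moreover have "S1 * S2 < \<infinity>"
    using F D by (simp add: bilipschitz_embedding_def)
  ultimately have "S1 < \<infinity>" "S2 < \<infinity>"
    by (auto simp: ennreal_mult_less_top less_top)
  then obtain L l where L: "S1 = ennreal L" "L \<ge> 0" and l: "S2 = ennreal l" "l \<ge> 0"
    by (metis infinity_ennreal_def ennreal_cases less_irrefl)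
  have lip: "dist (F (H x)) (F (H y)) \<le> L * dist x y" if "x \<in> X" "y \<in> X" for x y
  proof (cases "x = y")
    case False
    then show ?thesis
      using S1[OF that False] L by (simp add: field_simps)
  qed simp
  have colip: "dist x y \<le> l * dist (F (H x)) (F (H y))" if "x \<in> X" "y \<in> X" for x y
  proof (cases "x = y")
    case False
    then show ?thesis
      using S2[OF that False] l P[OF that False] by (simp add: field_simps)
  qed simp
  have "real s + 1 \<le> l * L * real s"
    by (rule lipschitz_constants_lower_bound[where f = "\<lambda>x. F (H x)" and X = X,
          OF K(1,2) lip colip L(2) l(2) r sep X])
  then have "(real s + 1) / real s \<le> L * l"
    using \<open>s \<ge> 1\<close> by (simp add: field_simps)
  then show ?thesis
    unfolding D L(1) l(1) using L(2) l(2) by (simp flip: ennreal_mult)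
qed

section \<open>The two bounds combined\<close>

theorem mainTheorem2:
  assumes "compact (UNIV :: 'k::metric_space set)"
    and "\<exists>h :: real \<Rightarrow> 'u. inj h"
  shows "(cb_order (UNIV :: 'k set) = 1 \<longrightarrow>
           class_embedding_const (C_metric :: ('k \<Rightarrow>\<^sub>C real) metric)
             (separable_banach_metrics :: 'u metric set) = 2 \<and>
           class_embedding_const (C_metric :: ('k \<Rightarrow>\<^sub>C real) metric)
             (separable_metrics :: 'u metric set) = 2) \<and>
         (\<forall>s::nat. cb_order (UNIV :: 'k set) = enat s \<and> 2 \<le> s \<longrightarrow>
           ennreal ((real s + 1) / real s)
             \<le> class_embedding_const (C_metric :: ('k \<Rightarrow>\<^sub>C real) metric)
                 (separable_banach_metrics :: 'u metric set) \<and>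
           class_embedding_const (C_metric :: ('k \<Rightarrow>\<^sub>C real) metric)
               (separable_banach_metrics :: 'u metric set)
             \<le> class_embedding_const (C_metric :: ('k \<Rightarrow>\<^sub>C real) metric)
                 (separable_metrics :: 'u metric set) \<and>
           class_embedding_const (C_metric :: ('k \<Rightarrow>\<^sub>C real) metric)
               (separable_metrics :: 'u metric set)
             \<le> 2)"
proof -
  obtain h :: "real \<Rightarrow> 'u" where h: "inj h"
    using assms(2) by blast
  \<comment> \<open>The test space for the lower bound is a separable closed subspace containing all
    signs; it is carried to \<open>'u\<close> through the reals.\<close>
  obtain X D where X: "closed X" "subspace X" "countable D" "D \<subseteq> X" "X \<subseteq> closure D" "range sign_fun \<subseteq> X"
    using separable_closed_subspace_containing[of sign_fun] by blast
  obtain g :: "((nat \<Rightarrow> real) \<Rightarrow>\<^sub>C real) \<Rightarrow> real" where "inj_on g X"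
    using separable_injects_into_real[OF X(3,5)] .
  then have H: "inj_on (h \<circ> g) X"
    using h by (intro comp_inj_on) (auto intro: inj_on_subset)
  define M where "M = metric ((h \<circ> g) ` X, \<lambda>u v. dist (the_inv_into X (h \<circ> g) u) (the_inv_into X (h \<circ> g) v))"
  note M = separable_banach_copy[OF X(1-5) H, folded M_def]
  have X_add: "x + sign_fun n \<in> X" if "x \<in> X" for x n
    using subspace_add[OF X(2) that] X(6) by blast
  have lower: "ennreal ((real s + 1) / real s) \<le>
      class_embedding_const (C_metric :: ('k \<Rightarrow>\<^sub>C real) metric) (separable_banach_metrics :: 'u metric set)"
    if s: "cb_order (UNIV :: 'k set) = enat s" "s \<ge> 1" for s
  proof -
    have "ennreal ((real s + 1) / real s) \<le> embedding_const (C_metric :: ('k \<Rightarrow>\<^sub>C real) metric) M"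
      unfolding embedding_const_def
    proof (rule INF_greatest, clarify)
      fix F :: "'u \<Rightarrow> ('k \<Rightarrow>\<^sub>C real)"
      assume F: "bilipschitz_embedding M C_metric F"
      show "ennreal ((real s + 1) / real s) \<le> distortion M C_metric F"
        by (rule distortion_lower_bound[OF assms(1) cb_deriv_finite_order(1)[OF s] s(2) M(2,3) H
              norm_sign_fun norm_sign_fun_sums subspace_0[OF X(2)] X_add F])
    qed
    also have "\<dots> \<le> class_embedding_const (C_metric :: ('k \<Rightarrow>\<^sub>C real) metric) (separable_banach_metrics :: 'u metric set)"
      unfolding class_embedding_const_def using M(1) by (rule SUP_upper)
    finally show ?thesis .
  qed
  have mono: "class_embedding_const (C_metric :: ('k \<Rightarrow>\<^sub>C real) metric) (separable_banach_metrics :: 'u metric set)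
      \<le> class_embedding_const (C_metric :: ('k \<Rightarrow>\<^sub>C real) metric) (separable_metrics :: 'u metric set)"
    unfolding class_embedding_const_def
    by (intro SUP_subset_mono) (auto simp: separable_banach_metrics_def separable_metrics_def)
  have upper: "class_embedding_const (C_metric :: ('k \<Rightarrow>\<^sub>C real) metric) (separable_metrics :: 'u metric set) \<le> 2"
    if s: "cb_order (UNIV :: 'k set) = enat s" "s \<ge> 1" for s
  proof -
    obtain x0 :: 'k where "x0 islimpt UNIV"
      using cb_deriv_finite_order(2)[OF s] by (auto simp: cb_deriv_iff)
    then show ?thesis
      unfolding class_embedding_const_def separable_metrics_def
      by (intro SUP_least) (auto intro: embedding_const_separable_le_2[OF assms(1)])
  qed
  show ?thesis
  proof (intro conjI impI allI)
    assume "cb_order (UNIV :: 'k set) = 1"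
    then have 1: "cb_order (UNIV :: 'k set) = enat 1"
      by (simp add: one_enat_def)
    \<comment> \<open>At s = 1 the lower bound (s + 1) / s is 2 and meets the upper one.\<close>
    have "2 \<le> class_embedding_const (C_metric :: ('k \<Rightarrow>\<^sub>C real) metric) (separable_banach_metrics :: 'u metric set)"
      using lower[OF 1] by simp
    with upper[OF 1] mono
    show "class_embedding_const (C_metric :: ('k \<Rightarrow>\<^sub>C real) metric) (separable_banach_metrics :: 'u metric set) = 2"
      "class_embedding_const (C_metric :: ('k \<Rightarrow>\<^sub>C real) metric) (separable_metrics :: 'u metric set) = 2"
      by (auto intro: antisym order_trans)
  qed (use lower upper mono in auto)
qed

end
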